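(* Let $\phi^t$ be a reparametrized linear flow (in the sense of the context) with stopping points at $\mathbf p$ and $\mathbf q$. If $\phi^t$ has a physical measure, then this measure is equal to $$\mu_\infty=\frac{\sqrt{d_{\mathbf q}}}{\sqrt{d_{\mathbf p}}+\sqrt{d_{\mathbf q}}}\delta_{\mathbf p}+\frac{\sqrt{d_{\mathbf p}}}{\sqrt{d_{\mathbf p}}+\sqrt{d_{\mathbf q}}}\delta_{\mathbf q}.$$
   Context: Let $\mathbb T^2=\mathbb R^2/\mathbb Z^2$, and let $\lambda^2$ be Lebesgue (Haar) measure on $\mathbb T^2$. A reparametrized linear flow with angle $\alpha$ and stopping points at $\mathbf p$ and $\mathbf q$ is the flow $\phi^t$ on $\mathbb T^2$ generated by a vector field $X=\varphi X_0$ such that: $X_0=(1,\alpha)$ with $\alpha\in\mathbb R$ irrational; $\varphi:\mathbb T^2\to[0,\infty)$ is of class $C^3$; $\varphi$ vanishes at two distinct points $\mathbf p,\mathbf q$ and is positive elsewhere; the Hessians $D^2\varphi(\mathbf p)$ and $D^2\varphi(\mathbf q)$ are positive definite. Put $d_{\mathbf p}=\det D^2\varphi(\mathbf p)$, $d_{\mathbf q}=\det D^2\varphi(\mathbf q)$. For $\mathbf x\in\mathbb T^2$ and $t>0$ the empirical measure $\mu^t_{\mathbf x}$ is the Borel probability with $\int f\,d\mu^t_{\mathbf x}=\frac1t\int_0^t f(\phi^s(\mathbf x))\,ds$ for continuous $f$, and $p\omega(\mathbf x)=\bigcap_{T>0}\overline{\{\mu^t_{\mathbf x}:t\ge T\}}$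 (weak-* closure). A Borel probability $\mu$ on $\mathbb T^2$ is physical for $\phi^t$ if its basin $\{\mathbf x:p\omega(\mathbf x)=\{\mu\}\}$ has positive $\lambda^2$-measure. *)

theory Defs
  imports "HOL-Probability.Probability"
begin

definition torus_rel :: "real^2 \<Rightarrow> real^2 \<Rightarrow> bool" where
  "torus_rel x y \<longleftrightarrow> (\<forall>i. x $ i - y $ i \<in> \<int>)"

lemma equivp_torus_rel: "equivp torus_rel"
proof (rule equivpI)
  show "reflp torus_rel"
    by (simp add: reflp_def torus_rel_def)
  show "symp torus_rel"
    unfolding symp_def torus_rel_def by (metis Ints_minus minus_diff_eq)
  show "transp torus_rel"
  proof (rule transpI)
    fix x y z assume xy: "torus_rel x y" and yz: "torus_rel y z"
    show "torus_rel x z"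
      unfolding torus_rel_def
    proof
      fix i
      have "(x $ i - y $ i) + (y $ i - z $ i) \<in> \<int>"
        using xy yz unfolding torus_rel_def by (intro Ints_add) auto
      then show "x $ i - z $ i \<in> \<int>" by simp
    qed
  qed
qed

quotient_type torus = "real^2" / torus_rel
  morphisms rep_torus to_torus
  by (rule equivp_torus_rel)

lemma to_torus_eq_iff: "to_torus x = to_torus y \<longleftrightarrow> (\<forall>i. x $ i - y $ i \<in> \<int>)"
  using torus.abs_eq_iff[of x y] by (simp add: torus_rel_def)

lemma to_torus_rep_torus: "to_torus (rep_torus x) = x"
  by (rule Quotient_abs_rep[OF Quotient_torus])

instantiation torus :: topological_space
begin

definition open_torus :: "torus set \<Rightarrow> bool" where
  "open_torus U \<longleftrightarrow> open (to_torus -` U)"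

instance
proof
  show "open (UNIV :: torus set)"
    by (simp add: open_torus_def)
next
  fix S T :: "torus set" assume "open S" "open T"
  then show "open (S \<inter> T)"
    by (simp add: open_torus_def vimage_Int open_Int)
next
  fix K :: "torus set set" assume "\<forall>S\<in>K. open S"
  then show "open (\<Union>K)"
    by (auto simp: open_torus_def vimage_Union intro!: open_UN)
qed

end

lemma continuous_to_torus: "continuous_on UNIV to_torus"
  by (auto simp: continuous_on_open_vimage open_torus_def)

text \<open>Haar measure is the push-forward of Lebesgue measure on the fundamental domain
  \<open>[0,1)\<close> x \<open>[0,1)\<close>.\<close>

definition haar_torus :: "torus measure" where
  "haar_torus = distr (restrict_space lborel {x :: real^2. \<forall>i. 0 \<le> x $ i \<and> x $ i < 1}) borel to_torus"

lemma emeasure_haar_torus: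
  assumes "A \<in> sets borel"
  shows "emeasure haar_torus A =
    emeasure lborel (to_torus -` A \<inter> {x. \<forall>i. 0 \<le> x $ i \<and> x $ i < 1})"
proof -
  let ?D = "{x :: real^2. \<forall>i. 0 \<le> x $ i \<and> x $ i < 1}"
  have D: "?D \<in> sets lborel"
    by measurable
  have m: "to_torus \<in> measurable lborel borel"
    using borel_measurable_continuous_onI[OF continuous_to_torus] by simp
  have "emeasure haar_torus A = emeasure (restrict_space lborel ?D) (to_torus -` A \<inter> ?D)"
    unfolding haar_torus_def
    using measurable_restrict_space1[OF m] assms by (subst emeasure_distr) (auto simp: space_restrict_space)
  also have "\<dots> = emeasure lborel (to_torus -` A \<inter> ?D)"
    using D by (intro emeasure_restrict_space) auto
  finally show ?thesis .
qed

text \<open>\<open>C_k n f\<close>: all iterated directional derivatives of \<open>f\<close> up to order \<open>n\<close> exist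
  (as Frechet derivatives) and are continuous. A function on the torus is \<open>C_k\<close> if its
  periodic lift to the plane is.\<close>

primrec C_k :: "nat \<Rightarrow> (real^2 \<Rightarrow> real) \<Rightarrow> bool" where
  "C_k 0 f \<longleftrightarrow> continuous_on UNIV f"
| "C_k (Suc n) f \<longleftrightarrow>
     (\<forall>x. f differentiable (at x)) \<and> (\<forall>v. C_k n (\<lambda>x. frechet_derivative f (at x) v))"

definition partial_deriv :: "2 \<Rightarrow> (real^2 \<Rightarrow> real) \<Rightarrow> real^2 \<Rightarrow> real" where
  "partial_deriv i f x = frechet_derivative f (at x) (axis i 1)"

text \<open>By periodicity of the lift, the chosen representative \<open>rep_torus p\<close> does not matter.\<close>

definition hessian :: "(torus \<Rightarrow> real) \<Rightarrow> torus \<Rightarrow> real^2^2" where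
  "hessian f p = (\<chi> i j. partial_deriv i (partial_deriv j (f \<circ> to_torus)) (rep_torus p))"

definition pos_definite :: "real^2^2 \<Rightarrow> bool" where
  "pos_definite A \<longleftrightarrow> transpose A = A \<and> (\<forall>v. v \<noteq> 0 \<longrightarrow> v \<bullet> (A *v v) > 0)"

text \<open>The tangent bundle of the torus is trivial, so a vector field is a map into the plane;
  integral curves are the projections of integral curves of the lifted field.\<close>

definition generates_flow :: "(torus \<Rightarrow> real^2) \<Rightarrow> (real \<Rightarrow> torus \<Rightarrow> torus) \<Rightarrow> bool" where
  "generates_flow X F \<longleftrightarrow>
     (\<forall>x. \<exists>\<gamma> :: real \<Rightarrow> real^2.
        \<gamma> 0 = x \<and>
        (\<forall>t. (\<gamma> has_vector_derivative X (to_torus (\<gamma> t))) (at t)) \<and>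
        (\<forall>t. F t (to_torus x) = to_torus (\<gamma> t)))"

definition reparam_linear_flow ::
  "real \<Rightarrow> (torus \<Rightarrow> real) \<Rightarrow> torus \<Rightarrow> torus \<Rightarrow> (real \<Rightarrow> torus \<Rightarrow> torus) \<Rightarrow> bool" where
  "reparam_linear_flow \<alpha> \<phi> p q F \<longleftrightarrow>
     \<alpha> \<notin> \<rat> \<and>
     C_k 3 (\<phi> \<circ> to_torus) \<and>
     p \<noteq> q \<and> \<phi> p = 0 \<and> \<phi> q = 0 \<and> (\<forall>x. x \<noteq> p \<and> x \<noteq> q \<longrightarrow> \<phi> x > 0) \<and>
     pos_definite (hessian \<phi> p) \<and> pos_definite (hessian \<phi> q) \<and>
     generates_flow (\<lambda>x. \<phi> x *\<^sub>R vector [1, \<alpha>]) F"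

definition borel_probs :: "torus measure set" where
  "borel_probs = {M. sets M = sets borel \<and> prob_space M}"

text \<open>The coarsest topology on \<open>borel_probs\<close> making integration of each continuous function
  continuous.\<close>

definition weak_star :: "torus measure topology" where
  "weak_star = topology_generated_by
     {{M \<in> borel_probs. (\<integral>x. f x \<partial>M) \<in> U} | (f :: torus \<Rightarrow> real) U. continuous_on UNIV f \<and> open U}"

lemma topspace_weak_star: "topspace weak_star = borel_probs"
proof
  show "topspace weak_star \<subseteq> borel_probs"
    unfolding weak_star_def topology_generated_by_topspace by auto
next
  have "{M \<in> borel_probs. (\<integral>x. (0::real) \<partial>M) \<in> UNIV} \<in>
     {{M \<in> borel_probs. (\<integral>x. f x \<partial>M) \<in> U} | (f :: torus \<Rightarrow> real) U. continuous_on UNIV f \<and> open U}"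
    by (intro CollectI exI[of _ "\<lambda>x::torus. 0::real"] exI[of _ "UNIV :: real set"]) auto
  then show "borel_probs \<subseteq> topspace weak_star"
    unfolding weak_star_def topology_generated_by_topspace by auto
qed

text \<open>\<open>is_empirical F t x M\<close>: \<open>M\<close> is the empirical measure of the orbit segment of \<open>x\<close> up to
  time \<open>t\<close>, i.e. the Borel probability prescribed on continuous functions by time averages.\<close>

definition is_empirical :: "(real \<Rightarrow> torus \<Rightarrow> torus) \<Rightarrow> real \<Rightarrow> torus \<Rightarrow> torus measure \<Rightarrow> bool" where
  "is_empirical F t x M \<longleftrightarrow> M \<in> borel_probs \<and>
     (\<forall>f :: torus \<Rightarrow> real. continuous_on UNIV f \<longrightarrow>
        (\<integral>y. f y \<partial>M) = 1 / t * integral {0..t} (\<lambda>s. f (F s x)))"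

definition p_omega :: "(real \<Rightarrow> torus \<Rightarrow> torus) \<Rightarrow> torus \<Rightarrow> torus measure set" where
  "p_omega F x = (\<Inter>T\<in>{0<..}. weak_star closure_of {M. \<exists>t\<ge>T. is_empirical F t x M})"

definition physical_measure :: "(real \<Rightarrow> torus \<Rightarrow> torus) \<Rightarrow> torus measure \<Rightarrow> bool" where
  "physical_measure F \<mu> \<longleftrightarrow> \<mu> \<in> borel_probs \<and> emeasure haar_torus {x. p_omega F x = {\<mu>}} > 0"

definition two_diracs :: "real \<Rightarrow> torus \<Rightarrow> real \<Rightarrow> torus \<Rightarrow> torus measure" where
  "two_diracs a p b q = measure_of UNIV (sets borel)
     (\<lambda>A. ennreal a * emeasure (return borel p) A + ennreal b * emeasure (return borel q) A)"

lemma sets_two_diracs: "sets (two_diracs a p b q) = sets borel"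
  unfolding two_diracs_def by (metis sets.sets_measure_of_eq space_borel)

lemma emeasure_two_diracs:
  assumes "A \<in> sets borel"
  shows "emeasure (two_diracs a p b q) A =
    ennreal a * emeasure (return borel p) A + ennreal b * emeasure (return borel q) A"
proof (rule emeasure_measure_of[OF two_diracs_def])
  show "sets borel \<subseteq> Pow (UNIV :: torus set)" by simp
  show "A \<in> sets (two_diracs a p b q)"
    using assms by (simp add: sets_two_diracs)
  show "positive (sets (two_diracs a p b q))
     (\<lambda>A. ennreal a * emeasure (return borel p) A + ennreal b * emeasure (return borel q) A)"
    by (simp add: positive_def)
  show "countably_additive (sets (two_diracs a p b q))
     (\<lambda>A. ennreal a * emeasure (return borel p) A + ennreal b * emeasure (return borel q) A)"
  proof (rule countably_additiveI)
    fix B :: "nat \<Rightarrow> torus set"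
    assume B: "range B \<subseteq> sets (two_diracs a p b q)" "disjoint_family B"
    have s: "(\<Sum>i. emeasure (return borel r) (B i)) = emeasure (return borel r) (\<Union>i. B i)" for r :: torus
      using B by (intro suminf_emeasure) (auto simp: sets_two_diracs)
    show "(\<Sum>i. ennreal a * emeasure (return borel p) (B i) + ennreal b * emeasure (return borel q) (B i)) =
       ennreal a * emeasure (return borel p) (\<Union>i. B i) + ennreal b * emeasure (return borel q) (\<Union>i. B i)"
      by (simp add: suminf_add[symmetric] s)
  qed
qed

end

(*
  Along a line X + s(1,\<alpha>), the flow needs time 1/\<phi> per unit of length. Crossing a neighbourhood of a
  stopping point r at transverse distance \<eta> takes time c(r)/|\<eta>| + o(1/|\<eta>|), c(r) = 2 pi / sqrt(det D^2 \<phi>(r)),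
  because \<phi> is asymptotic to its Hessian form there. The successive transverse distances are
  those of an orbit of the rotation by \<alpha>. If |\<alpha> - a/N| < 1/N^2, the first N
  orbit points lie one in each arc of a 1/N-grid, so (Denjoy-Koksma) the sum of 1/|\<eta>| over N
  crossings is 2 N ln N + o(N ln N), unless some \<eta> is smaller than 1/(N sqrt(ln N)); this
  exception has measure O(1/sqrt(ln N)). Hence almost every point sees, for infinitely many N, the
  time spent near p and q in the ratio c(p) : c(q), and the measure with these weights lies in
  the limit set of its empirical measures. A physical measure is the only element of
  that limit set for a set of points of positive measure.
*)

theory Submission
  imports Defs "HOL-Analysis.Harmonic_Numbers" "HOL-Analysis.Kronecker_Approximation_Theorem"
begin

section \<open>Second-order behaviour at a minimum\<close>

text \<open>The reciprocal distance 1/|\<eta>| is not integrable, so Birkhoff's theorem does not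
  control the crossing times, and a single close passage can outweigh all others. The cutoff 1/(N
  sqrt(ln N)) balances two demands. With \<psi> = sqrt(ln N), the few crossings nearest to a
  stopping point contribute O(N \<psi>), which must be o(N ln N); the excluded starting points have
  measure O(1/\<psi>), which must tend to 0, so that those excluded for all large N form a null set.
  The term 2 N ln N is independent of the start and equal for both stopping points, so it cancels in
  the time averages; c(r) being inversely proportional to sqrt(det), the weight at p carries the
  determinant at q. Only a subsequence of times is controlled, and one suitable point of the basin
  suffices. It is sought on a vertical line: there the phases at which p and q are passed are
  constant, and the offsets are translates of a rotation orbit by the height, so the exclusion
  becomes a one-dimensional estimate.\<close>

lemma C_k_SucD: "C_k (Suc n) f \<Longrightarrow> C_k n f"
proof (induction n arbitrary: f)
  case 0
  then show ?case
    by (auto intro!: continuous_at_imp_continuous_on differentiable_imp_continuous_within)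
next
  case (Suc n)
  have "\<forall>x. f differentiable (at x)" "C_k (Suc n) (\<lambda>x. frechet_derivative f (at x) v)" for v
    using Suc.prems C_k.simps(2)[of "Suc n" f] by blast+
  then show ?case using Suc.IH by (simp only: C_k.simps(2)[of n f]) blast
qed

lemma inner_matrix_vector_sum:
  fixes A :: "real^'n^'n"
  shows "w \<bullet> (A *v w) = (\<Sum>i\<in>UNIV. \<Sum>j\<in>UNIV. w$i * w$j * A$i$j)"
  by (simp add: inner_vec_def matrix_vector_mult_def sum_distrib_left mult_ac)

lemma frechet_derivative_eq_sum_partial_deriv:
  assumes "f differentiable (at x)"
  shows "frechet_derivative f (at x) w = (\<Sum>i\<in>UNIV. w$i * partial_deriv i f x)"
proof -
  interpret linear "frechet_derivative f (at x)"
    by (rule linear_frechet_derivative[OF assms])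
  have "w = (\<Sum>i\<in>UNIV. w$i *\<^sub>R axis i 1)"
    using basis_expansion[of w] by (simp add: scalar_mult_eq_scaleR)
  then have "frechet_derivative f (at x) w = frechet_derivative f (at x) (\<Sum>i\<in>UNIV. w$i *\<^sub>R axis i 1)"
    by simp
  also have "\<dots> = (\<Sum>i\<in>UNIV. w$i * partial_deriv i f x)"
    by (simp add: sum scale partial_deriv_def)
  finally show ?thesis .
qed

lemma C_k_Suc_partial_deriv: "C_k (Suc n) f \<Longrightarrow> C_k n (partial_deriv i f)"
  by (simp add: partial_deriv_def[abs_def])

lemma second_derivative_eq_sum:
  assumes "C_k 2 h"
  shows "frechet_derivative (\<lambda>x. frechet_derivative h (at x) w) (at z) w =
    (\<Sum>i\<in>UNIV. \<Sum>j\<in>UNIV. w$i * w$j * partial_deriv i (partial_deriv j h) z)"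
proof -
  have C: "C_k (Suc (Suc 0)) h" using assms by (simp add: numeral_2_eq_2)
  have d: "h differentiable (at x)" for x using C by simp
  have d2: "partial_deriv j h differentiable (at x)" for x j
    using C_k_Suc_partial_deriv[OF C] by simp
  have "((\<lambda>x. \<Sum>j\<in>UNIV. w$j * partial_deriv j h x) has_derivative
     (\<lambda>v. \<Sum>j\<in>UNIV. w$j * frechet_derivative (partial_deriv j h) (at z) v)) (at z)"
    using d2 by (auto intro!: derivative_eq_intros simp: frechet_derivative_works[symmetric])
  from frechet_derivative_at[OF this]
  have "frechet_derivative (\<lambda>x. frechet_derivative h (at x) w) (at z) w =
     (\<Sum>j\<in>UNIV. w$j * frechet_derivative (partial_deriv j h) (at z) w)"
    by (simp add: frechet_derivative_eq_sum_partial_deriv[OF d] fun_eq_iff)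
  also have "\<dots> = (\<Sum>j\<in>UNIV. \<Sum>i\<in>UNIV. w$i * w$j * partial_deriv i (partial_deriv j h) z)"
    by (simp add: frechet_derivative_eq_sum_partial_deriv[OF d2] sum_distrib_left mult_ac)
  also have "\<dots> = (\<Sum>i\<in>UNIV. \<Sum>j\<in>UNIV. w$i * w$j * partial_deriv i (partial_deriv j h) z)"
    by (rule sum.swap)
  finally show ?thesis .
qed

text \<open>Nonnegativity makes \<open>P\<close> a minimum, so the linear term vanishes. What
  remains is the Lagrange remainder, whose coefficients are continuous second partials and hence
  close to those at \<open>P\<close>.\<close>

lemma taylor2_at_zero_minimum:
  fixes h :: "real^2 \<Rightarrow> real"
  assumes C: "C_k 2 h" and h0: "h P = 0" and nn: "\<And>x. h x \<ge> 0"
    and A: "A = (\<chi> i j. partial_deriv i (partial_deriv j h) P)" and "\<epsilon> > 0"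
  shows "\<exists>r>0. \<forall>w. norm w < r \<longrightarrow> \<bar>h (P + w) - w \<bullet> (A *v w) / 2\<bar> \<le> \<epsilon> * (norm w)\<^sup>2"
proof -
  have C2: "C_k (Suc (Suc 0)) h" using C by (simp add: numeral_2_eq_2)
  define D2 where "D2 i j = partial_deriv i (partial_deriv j h)" for i j
  have cont: "continuous_on UNIV (D2 i j)" for i j
    unfolding D2_def using C_k_Suc_partial_deriv[OF C_k_Suc_partial_deriv[OF C2]] by simp
  \<comment> \<open>Four entries, each off by at most \<epsilon>/4 and weighted by at most |w|^2,
    then halved by the Taylor factor: the total is at most \<epsilon>/2 |w|^2.\<close>
  have "\<forall>\<^sub>F z in at P. \<forall>i j. dist (D2 i j z) (D2 i j P) < \<epsilon> / 4"
    using cont \<open>\<epsilon> > 0\<close>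
    by (intro eventually_all_finite tendstoD[OF continuous_on_tendsto_compose[OF cont]])
       (auto simp: tendsto_ident_at)
  then obtain r where r: "r > 0"
    and rD: "\<And>z i j. z \<noteq> P \<Longrightarrow> dist z P < r \<Longrightarrow> dist (D2 i j z) (D2 i j P) < \<epsilon> / 4"
    unfolding eventually_at by blast
  have D0: "frechet_derivative h (at P) = (\<lambda>v. 0)"
    using C2 h0 nn by (intro differential_zero_maxmin[of P UNIV h])
      (auto simp: frechet_derivative_works)
  have "\<bar>h (P + w) - w \<bullet> (A *v w) / 2\<bar> \<le> \<epsilon> * (norm w)\<^sup>2" if w: "norm w < r" for w
  proof -
    \<comment> \<open>The derivatives of t -> h(P + t w), indexed by their order as
      \<open>Maclaurin2\<close> expects.\<close>
    define d where "d m t = (if m = 0 then h (P + t *\<^sub>R w)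
       else if m = 1 then frechet_derivative h (at (P + t *\<^sub>R w)) w
       else frechet_derivative (\<lambda>x. frechet_derivative h (at x) w) (at (P + t *\<^sub>R w)) w)"
      for m :: nat and t :: real
    have chain: "((\<lambda>t. g (P + t *\<^sub>R w)) has_real_derivative frechet_derivative g (at (P + t *\<^sub>R w)) w) (at t)"
      if "g differentiable (at (P + t *\<^sub>R w))" for g t
    proof -
      have "(g has_derivative frechet_derivative g (at (P + t *\<^sub>R w))) (at (P + t *\<^sub>R w))"
        using that frechet_derivative_works by blast
      moreover have "((\<lambda>t. P + t *\<^sub>R w) has_derivative (\<lambda>s. s *\<^sub>R w)) (at t)"
        by (auto intro!: derivative_eq_intros)
      ultimately have "((\<lambda>t. g (P + t *\<^sub>R w)) has_derivative
          (\<lambda>s. frechet_derivative g (at (P + t *\<^sub>R w)) (s *\<^sub>R w))) (at t)"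
        using diff_chain_at[of "\<lambda>t. P + t *\<^sub>R w"] by (fastforce simp: o_def)
      then show ?thesis
        using linear.scaleR[OF linear_frechet_derivative[OF that]]
        by (simp add: has_field_derivative_def mult.commute[of _ "frechet_derivative g (at (P + t *\<^sub>R w)) w"])
    qed
    have "(d m has_real_derivative d (Suc m) t) (at t)" if "m < 2" for m t
      using C2 chain[of h t] chain[of "\<lambda>x. frechet_derivative h (at x) w" t] that
      unfolding d_def by (cases "m = 0") (auto simp: less_2_cases_iff)
    then have "\<exists>t. 0 < t \<and> t \<le> 1 \<and>
       h (P + 1 *\<^sub>R w) = (\<Sum>m<2. d m 0 / fact m * 1 ^ m) + d 2 t / fact 2 * 1 ^ 2"
      by (intro Maclaurin2[where f = "\<lambda>t. h (P + t *\<^sub>R w)"]) (auto simp: d_def[of 0])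
    then obtain t where t: "0 < t" "t \<le> 1" and e: "h (P + w) = d 2 t / 2"
      by (auto simp: d_def numeral_2_eq_2 h0 D0)
    have near: "\<bar>D2 i j (P + t *\<^sub>R w) - D2 i j P\<bar> \<le> \<epsilon> / 4" for i j
    proof (cases "w = 0")
      case False
      have "norm (t *\<^sub>R w) < r" using t w mult_left_le_one_le[of "norm w" t] by simp
      then show ?thesis using rD[of "P + t *\<^sub>R w" i j] False t by (simp add: dist_norm)
    qed (use \<open>\<epsilon> > 0\<close> in simp)
    have "h (P + w) - w \<bullet> (A *v w) / 2 =
       (\<Sum>i\<in>UNIV. \<Sum>j\<in>UNIV. w$i * w$j * (D2 i j (P + t *\<^sub>R w) - D2 i j P)) / 2"
      unfolding e inner_matrix_vector_sum A
      by (simp add: d_def second_derivative_eq_sum[OF C] D2_def right_diff_distrib sum_subtractf diff_divide_distrib)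
    also have "\<bar>\<dots>\<bar> \<le> (\<Sum>i\<in>(UNIV::2 set). \<Sum>j\<in>(UNIV::2 set). norm w * norm w * (\<epsilon> / 4)) / 2"
    proof -
      have "\<bar>\<Sum>i\<in>UNIV. \<Sum>j\<in>UNIV. w$i * w$j * (D2 i j (P + t *\<^sub>R w) - D2 i j P)\<bar> \<le>
        (\<Sum>i\<in>(UNIV::2 set). \<Sum>j\<in>(UNIV::2 set). norm w * norm w * (\<epsilon> / 4))"
      proof (rule order_trans[OF sum_abs], rule sum_mono, rule order_trans[OF sum_abs], rule sum_mono)
        fix i j
        show "\<bar>w$i * w$j * (D2 i j (P + t *\<^sub>R w) - D2 i j P)\<bar> \<le> norm w * norm w * (\<epsilon> / 4)"
          unfolding abs_mult using near[of i j] component_le_norm_cart[of w i] component_le_norm_cart[of w j]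
          by (intro mult_mono) auto
      qed
      then show ?thesis by simp
    qed
    also have "\<dots> \<le> \<epsilon> * (norm w)\<^sup>2"
      using \<open>\<epsilon> > 0\<close> by (simp add: power2_eq_square)
    finally show ?thesis .
  qed
  then show ?thesis using r by blast
qed

text \<open>Compactness of the unit circle gives a positive minimum of the form; homogeneity of
  degree 2 spreads it to all vectors.\<close>

lemma pos_definite_lower_bound:
  assumes "pos_definite A"
  shows "\<exists>c>0. \<forall>w. w \<bullet> (A *v w) \<ge> c * (norm w)\<^sup>2"
proof -
  let ?S = "sphere (0::real^2) 1"
  have "continuous_on ?S (\<lambda>w. w \<bullet> (A *v w))"
    by (intro continuous_intros matrix_vector_mult_linear_continuous_on)
  moreover have "?S \<noteq> {}" using norm_axis_1[of "1::2"] by (auto intro!: exI[of _ "axis 1 1"] simp: dist_norm)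
  ultimately obtain u where u: "u \<in> ?S" "\<And>w. w \<in> ?S \<Longrightarrow> u \<bullet> (A *v u) \<le> w \<bullet> (A *v w)"
    using continuous_attains_inf[of ?S "\<lambda>w. w \<bullet> (A *v w)"] by auto
  show ?thesis
  proof (intro exI conjI allI)
    have "u \<noteq> 0" using u(1) by auto
    then show "u \<bullet> (A *v u) > 0" using assms by (simp add: pos_definite_def)
    show "w \<bullet> (A *v w) \<ge> u \<bullet> (A *v u) * (norm w)\<^sup>2" for w
    proof (cases "w = 0")
      case False
      have "(w /\<^sub>R norm w) \<in> ?S" using False by simp
      from u(2)[OF this] have "u \<bullet> (A *v u) \<le> (w \<bullet> (A *v w)) / (norm w)\<^sup>2"
        by (simp add: matrix_vector_mult_scaleR power2_eq_square divide_inverse mult_ac)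
      then show ?thesis using False by (simp add: field_simps)
    qed simp
  qed
qed

text \<open>The form dominates a multiple of |w|^2, so the Taylor error becomes a relative one.
  Integrated along a crossing, it stays a fraction \<epsilon> of the main term. The factor
  \<open>f\<close> is carried along because time integrals of \<open>f\<close> become integrals of
  \<open>f / h\<close> over the line.\<close>

lemma local_asymptotics:
  fixes h f :: "real^2 \<Rightarrow> real"
  assumes C: "C_k 2 h" and h0: "h P = 0" and nn: "\<And>x. h x \<ge> 0"
    and A: "A = (\<chi> i j. partial_deriv i (partial_deriv j h) P)" and pd: "pos_definite A"
    and f: "continuous_on UNIV f" and "\<epsilon> > 0"
  shows "\<exists>r>0. \<forall>w. w \<noteq> 0 \<longrightarrow> norm w < r \<longrightarrow>
    \<bar>f (P + w) / h (P + w) - f P * (2 / (w \<bullet> (A *v w)))\<bar> \<le> \<epsilon> * (2 / (w \<bullet> (A *v w)))"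
proof -
  obtain c where c: "c > 0" "\<And>w. w \<bullet> (A *v w) \<ge> c * (norm w)\<^sup>2"
    using pos_definite_lower_bound[OF pd] by blast
  define K where "K = 1 + 2 * \<bar>f P\<bar>"
  have K: "K > 0" by (simp add: K_def)
  \<comment> \<open>The bound 1/2 keeps \<open>h\<close> above half of its quadratic part
    \<open>q\<close>; the other bound absorbs the factor 2 (1 + |f P|) that the last estimate
    produces.\<close>
  define \<delta> where "\<delta> = min (1/2) (\<epsilon> / (2 * K))"
  have \<delta>: "\<delta> > 0" "\<delta> \<le> 1/2" "\<delta> \<le> \<epsilon> / (2 * K)"
    using \<open>\<epsilon> > 0\<close> K unfolding \<delta>_def by (simp_all only: min.cobounded1 min.cobounded2) auto
  have \<delta>K: "\<delta> * K \<le> \<epsilon> / 2"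
    using \<delta>(3) K by (simp add: pos_le_divide_eq mult_ac)
  obtain r1 where r1: "r1 > 0" "\<And>w. norm w < r1 \<Longrightarrow> \<bar>h (P + w) - w \<bullet> (A *v w) / 2\<bar> \<le> (\<delta> * c / 2) * (norm w)\<^sup>2"
    using taylor2_at_zero_minimum[OF C h0 nn A, of "\<delta> * c / 2"] c(1) \<delta>(1) by auto
  have "isCont f P" using f by (simp add: continuous_on_eq_continuous_at)
  then obtain r2 where r2: "r2 > 0" "\<And>z. dist z P < r2 \<Longrightarrow> dist (f z) (f P) < \<delta>"
    using \<delta>(1) unfolding continuous_at_eps_delta by blast
  have "\<bar>f (P + w) / h (P + w) - f P * (2 / (w \<bullet> (A *v w)))\<bar> \<le> \<epsilon> * (2 / (w \<bullet> (A *v w)))"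
    if w: "w \<noteq> 0" "norm w < r1" "norm w < r2" for w
  proof -
    define q where "q = w \<bullet> (A *v w) / 2"
    have q: "q > 0" using pd w(1) by (auto simp: pos_definite_def q_def)
    have "\<delta> * (c * (norm w)\<^sup>2) \<le> \<delta> * (2 * q)"
      using c(2)[of w] \<delta>(1) by (intro mult_left_mono) (auto simp: q_def)
    moreover have "\<bar>h (P + w) - q\<bar> \<le> \<delta> * (c * (norm w)\<^sup>2) / 2"
      using r1(2)[OF w(2)] by (simp add: q_def mult.assoc)
    ultimately have "\<bar>h (P + w) - q\<bar> \<le> \<delta> * q" by linarith
    then have hw: "h (P + w) \<ge> q / 2" "\<bar>h (P + w) - q\<bar> \<le> \<delta> * q"
      using mult_right_mono[OF \<delta>(2), of q] q unfolding abs_le_iff by linarith+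
    have fw: "\<bar>f (P + w) - f P\<bar> \<le> \<delta>"
      using r2(2)[of "P + w"] w(3) by (auto simp: dist_norm dist_real_def)
    have hpos: "h (P + w) > 0" using hw q by linarith
    \<comment> \<open>Separates the variation of \<open>f\<close> from that of \<open>h\<close>.
      Both parts are O(\<delta> q), so one factor \<open>q\<close> of the denominator
      cancels.\<close>
    have "f (P + w) / h (P + w) - f P / q = (q * (f (P + w) - f P) + f P * (q - h (P + w))) / (h (P + w) * q)"
      using hpos q by (simp add: field_simps)
    also have "\<bar>\<dots>\<bar> \<le> (q * \<delta> + \<bar>f P\<bar> * (\<delta> * q)) / (h (P + w) * q)"
    proof -
      have "\<bar>q * (f (P + w) - f P)\<bar> \<le> q * \<delta>"
        unfolding abs_mult using q fw by (simp add: mult_left_mono)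
      moreover have "\<bar>f P * (q - h (P + w))\<bar> \<le> \<bar>f P\<bar> * (\<delta> * q)"
        unfolding abs_mult using hw(2) by (intro mult_left_mono) (auto simp: abs_minus_commute)
      ultimately have "\<bar>q * (f (P + w) - f P) + f P * (q - h (P + w))\<bar> \<le> q * \<delta> + \<bar>f P\<bar> * (\<delta> * q)"
        by linarith
      then show ?thesis using hpos q unfolding abs_divide by (simp add: divide_right_mono)
    qed
    also have "\<dots> = \<delta> * (1 + \<bar>f P\<bar>) / h (P + w)"
      using hpos q by (simp add: field_simps)
    also have "\<dots> \<le> \<delta> * (1 + \<bar>f P\<bar>) / (q / 2)"
      using hpos q hw(1) \<delta> by (intro divide_left_mono) auto
    also have "\<dots> \<le> \<epsilon> / q"
    proof -
      have "\<delta> * (1 + \<bar>f P\<bar>) \<le> \<delta> * K"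
        using \<delta>(1) by (intro mult_left_mono) (auto simp: K_def)
      then have "2 * (\<delta> * (1 + \<bar>f P\<bar>)) \<le> \<epsilon>" using \<delta>K by linarith
      then have "2 * (\<delta> * (1 + \<bar>f P\<bar>)) / q \<le> \<epsilon> / q" using q by (intro divide_right_mono) auto
      then show ?thesis by (simp add: mult_ac)
    qed
    finally show ?thesis using q by (simp add: q_def)
  qed
  then show ?thesis using r1(1) r2(1) by (intro exI[of _ "min r1 r2"]) auto
qed

section \<open>Crossing times\<close>

text \<open>Completing the square gives an arctan primitive. Over the whole line the integral is
  exactly 2 pi / (s |\<eta>|), where \<open>s\<close> is the root of the discriminant; as
  \<open>a\<close> is interior to the interval, the two missing tails are a vanishing fraction of it
  when \<eta> tends to 0.\<close>

lemma quadratic_crossing_integral: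
  fixes A B C a \<epsilon> :: real
  assumes A: "A > 0" and d: "A * C - B\<^sup>2 > 0" and a: "0 < a" "a < 1" and "\<epsilon> > 0"
  shows "\<exists>M. \<forall>\<eta>. \<eta> \<noteq> 0 \<longrightarrow> (\<exists>I.
    ((\<lambda>\<sigma>. 2 / (A * (\<sigma> - a)\<^sup>2 + 2 * B * (\<sigma> - a) * \<eta> + C * \<eta>\<^sup>2)) has_integral I) {0..1} \<and>
    \<bar>I - 2 * pi / sqrt (A * C - B\<^sup>2) / \<bar>\<eta>\<bar>\<bar> \<le> \<epsilon> / \<bar>\<eta>\<bar> + M)"
proof -
  define s where "s = sqrt (A * C - B\<^sup>2)"
  have s: "s > 0" "s\<^sup>2 = A * C - B\<^sup>2" using d by (auto simp: s_def)
  define g where "g \<sigma> \<eta> = arctan ((A * (\<sigma> - a) + B * \<eta>) / (\<bar>\<eta>\<bar> * s))" for \<sigma> \<eta>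
  define I where "I \<eta> = 2 / (\<bar>\<eta>\<bar> * s) * (g 1 \<eta> - g 0 \<eta>)" for \<eta>
  have integral: "((\<lambda>\<sigma>. 2 / (A * (\<sigma> - a)\<^sup>2 + 2 * B * (\<sigma> - a) * \<eta> + C * \<eta>\<^sup>2)) has_integral I \<eta>) {0..1}"
    if "\<eta> \<noteq> 0" for \<eta>
  proof -
    define k where "k = \<bar>\<eta>\<bar> * s"
    have k: "k > 0" "k\<^sup>2 = \<eta>\<^sup>2 * (A * C - B\<^sup>2)" using that s by (auto simp: k_def power_mult_distrib)
    have "((\<lambda>\<sigma>. 2 / k * g \<sigma> \<eta>) has_vector_derivative
        2 / (A * (\<sigma> - a)\<^sup>2 + 2 * B * (\<sigma> - a) * \<eta> + C * \<eta>\<^sup>2)) (at \<sigma> within {0..1})" for \<sigma>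
    proof -
      define y where "y = A * (\<sigma> - a) + B * \<eta>"
      have "((\<lambda>\<sigma>. 2 / k * g \<sigma> \<eta>) has_real_derivative 2 / k * (inverse (1 + (y / k)\<^sup>2) * (A / k))) (at \<sigma> within {0..1})"
        unfolding g_def y_def k_def[symmetric] using k
        by (auto intro!: derivative_eq_intros)
      moreover have "2 / k * (inverse (1 + (y / k)\<^sup>2) * (A / k)) =
          2 / (A * (\<sigma> - a)\<^sup>2 + 2 * B * (\<sigma> - a) * \<eta> + C * \<eta>\<^sup>2)"
      proof -
        have "2 / k * (inverse (1 + (y / k)\<^sup>2) * (A / k)) = 2 * A / (k\<^sup>2 + y\<^sup>2)"
        proof -
          have "1 + (y / k)\<^sup>2 = (k\<^sup>2 + y\<^sup>2) / k\<^sup>2" using k(1) by (simp add: power_divide add_divide_distrib)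
          then show ?thesis using k(1) by (simp add: power2_eq_square)
        qed
        also have "k\<^sup>2 + y\<^sup>2 = A * (A * (\<sigma> - a)\<^sup>2 + 2 * B * (\<sigma> - a) * \<eta> + C * \<eta>\<^sup>2)"
          unfolding k(2) y_def by algebra
        finally show ?thesis using A by simp
      qed
      ultimately show ?thesis by (simp add: has_real_derivative_iff_has_vector_derivative)
    qed
    then have "((\<lambda>\<sigma>. 2 / (A * (\<sigma> - a)\<^sup>2 + 2 * B * (\<sigma> - a) * \<eta> + C * \<eta>\<^sup>2)) has_integral
        2 / k * g 1 \<eta> - 2 / k * g 0 \<eta>) {0..1}"
      by (intro fundamental_theorem_of_calculus) auto
    then show ?thesis
      by (simp add: I_def k_def right_diff_distrib)
  qed
  define c where "c = 2 * pi / s"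
  have c: "c > 0" using s by (simp add: c_def)
  have bound: "0 \<le> I \<eta> \<and> I \<eta> \<le> c / \<bar>\<eta>\<bar>" if "\<eta> \<noteq> 0" for \<eta>
  proof -
    have "A * (0 - a) + B * \<eta> \<le> A * (1 - a) + B * \<eta>" using A by (simp add: algebra_simps)
    then have "g 0 \<eta> \<le> g 1 \<eta>"
      unfolding g_def arctan_le_iff using s that by (intro divide_right_mono) auto
    moreover have "g 1 \<eta> - g 0 \<eta> \<le> pi"
      using arctan_bounded[of "(A * (1 - a) + B * \<eta>) / (\<bar>\<eta>\<bar> * s)"]
        arctan_bounded[of "(A * (0 - a) + B * \<eta>) / (\<bar>\<eta>\<bar> * s)"] unfolding g_def by linarith
    ultimately have "0 \<le> 2 / (\<bar>\<eta>\<bar> * s) * (g 1 \<eta> - g 0 \<eta>)"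
      "2 / (\<bar>\<eta>\<bar> * s) * (g 1 \<eta> - g 0 \<eta>) \<le> 2 / (\<bar>\<eta>\<bar> * s) * pi"
      using s by (auto intro!: mult_nonneg_nonneg divide_right_mono)
    then show ?thesis by (simp add: I_def c_def mult_ac)
  qed
  \<comment> \<open>The endpoints lie on opposite sides of \<open>a\<close>, so the numerators tend
    to A (1 - a) > 0 and -A a < 0 over a denominator shrinking to 0, and the arctans tend to pi/2
    and -pi/2.\<close>
  have lim: "((\<lambda>\<eta>. 2 / s * (g 1 \<eta> - g 0 \<eta>)) \<longlongrightarrow> 2 / s * (pi / 2 - - (pi / 2))) (at 0)"
  proof (intro tendsto_intros)
    have den: "((\<lambda>\<eta>. \<bar>\<eta>\<bar> * s) \<longlongrightarrow> 0) (at 0)" by (auto intro!: tendsto_eq_intros)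
    have pos: "\<forall>\<^sub>F \<eta> in at 0. 0 < \<bar>\<eta>\<bar> * s"
      using s by (auto simp: eventually_at intro!: exI[of _ 1])
    have "filterlim (\<lambda>\<eta>. (A * (1 - a) + B * \<eta>) / (\<bar>\<eta>\<bar> * s)) at_top (at 0)"
      using A a by (intro LIM_at_top_divide[where a = "A * (1 - a)"] den pos) (auto intro!: tendsto_eq_intros)
    then show "((\<lambda>\<eta>. g 1 \<eta>) \<longlongrightarrow> pi / 2) (at 0)"
      unfolding g_def by (rule filterlim_compose[OF tendsto_arctan_at_top])
    have "filterlim (\<lambda>\<eta>. (A * a - B * \<eta>) / (\<bar>\<eta>\<bar> * s)) at_top (at 0)"
      using A a by (intro LIM_at_top_divide[where a = "A * a"] den pos) (auto intro!: tendsto_eq_intros)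
    then have "filterlim (\<lambda>\<eta>. - ((A * a - B * \<eta>) / (\<bar>\<eta>\<bar> * s))) at_bot (at 0)"
      by (simp add: filterlim_uminus_at_top)
    moreover have "(\<lambda>\<eta>. - ((A * a - B * \<eta>) / (\<bar>\<eta>\<bar> * s))) = (\<lambda>\<eta>. (A * (0 - a) + B * \<eta>) / (\<bar>\<eta>\<bar> * s))"
      by (simp add: fun_eq_iff minus_divide_left)
    ultimately show "((\<lambda>\<eta>. g 0 \<eta>) \<longlongrightarrow> - (pi / 2)) (at 0)"
      unfolding g_def using filterlim_compose[OF tendsto_arctan_at_bot] by force
  qed
  have "\<forall>\<^sub>F \<eta> in at 0. dist (2 / s * (g 1 \<eta> - g 0 \<eta>)) c < \<epsilon>"
    using tendstoD[OF lim \<open>\<epsilon> > 0\<close>] by (simp add: c_def mult_ac)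
  then obtain r where r: "r > 0"
      "\<And>\<eta>. \<eta> \<noteq> 0 \<Longrightarrow> \<bar>\<eta>\<bar> < r \<Longrightarrow> \<bar>2 / s * (g 1 \<eta> - g 0 \<eta>) - c\<bar> < \<epsilon>"
    unfolding eventually_at by (auto simp: dist_real_def)
  \<comment> \<open>For |\<eta>| \<ge> r both terms lie between 0 and c / r, which fixes the
    additive constant.\<close>
  have "\<bar>I \<eta> - c / \<bar>\<eta>\<bar>\<bar> \<le> \<epsilon> / \<bar>\<eta>\<bar> + c / r" if "\<eta> \<noteq> 0" for \<eta>
  proof (cases "\<bar>\<eta>\<bar> < r")
    case True
    have "I \<eta> - c / \<bar>\<eta>\<bar> = (2 / s * (g 1 \<eta> - g 0 \<eta>) - c) / \<bar>\<eta>\<bar>"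
      by (simp add: I_def diff_divide_distrib right_diff_distrib mult.commute)
    then have "\<bar>I \<eta> - c / \<bar>\<eta>\<bar>\<bar> = \<bar>2 / s * (g 1 \<eta> - g 0 \<eta>) - c\<bar> / \<bar>\<eta>\<bar>" by (simp add: abs_divide)
    also have "\<dots> \<le> \<epsilon> / \<bar>\<eta>\<bar>" using r(2)[OF that True] by (intro divide_right_mono) auto
    also have "\<dots> \<le> \<epsilon> / \<bar>\<eta>\<bar> + c / r" using c r(1) by simp
    finally show ?thesis .
  next
    case False
    have "c / \<bar>\<eta>\<bar> \<le> c / r" using False r(1) c by (intro divide_left_mono) auto
    moreover have "\<epsilon> / \<bar>\<eta>\<bar> \<ge> 0" using \<open>\<epsilon> > 0\<close> by simp
    moreover have "\<bar>I \<eta> - c / \<bar>\<eta>\<bar>\<bar> \<le> c / \<bar>\<eta>\<bar>" using bound[OF that] by linarith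
    ultimately show ?thesis by linarith
  qed
  then show ?thesis using integral unfolding c_def s_def by blast
qed

section \<open>Reciprocal sums along rotations\<close>

text \<open>The representative of \<open>y\<close> modulo 1 in [-1/2, 1/2]; its absolute value is
  the distance to 0 in R/Z.\<close>

definition centered :: "real \<Rightarrow> real" where
  "centered y = y - of_int (round y)"

lemma abs_centered_le_half: "\<bar>centered y\<bar> \<le> 1/2"
  using of_int_round_abs_le[of y] by (simp add: centered_def abs_minus_commute)

lemma abs_centered_le: "\<bar>centered y\<bar> \<le> \<bar>y - of_int k\<bar>"
  unfolding centered_def by (rule round_diff_minimal)

lemma centered_eqE: obtains k :: int where "centered y = y - of_int k"
  by (simp add: centered_def)

text \<open>The combinatorial half of Denjoy-Koksma. By coprimality, the multiples of
  \<open>a\<close> run through every residue modulo \<open>N\<close> once. Rounding \<theta> to the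
  grid and the drift i |\<alpha> - a/N| cost at most 1/N each, which gives the slack 2/N.\<close>

lemma rotation_points_near_grid:
  fixes \<alpha> \<theta> :: real and a :: int and N :: nat
  assumes N: "N > 0" and cop: "coprime a (int N)" and appr: "\<bar>\<alpha> - of_int a / real N\<bar> < 1 / (real N)\<^sup>2"
  shows "\<exists>j. bij_betw j {..<N} {- int (N div 2)..<int N - int (N div 2)} \<and>
    (\<forall>i<N. (\<bar>of_int (j i)\<bar> - 2) / N \<le> \<bar>centered (\<theta> + real i * \<alpha>)\<bar> \<and>
           \<bar>centered (\<theta> + real i * \<alpha>)\<bar> \<le> (\<bar>of_int (j i)\<bar> + 2) / N)"
proof -
  define m where "m = int (N div 2)"
  define t where "t = \<lfloor>\<theta> * N\<rfloor>"
  \<comment> \<open>Subtracting \<open>m\<close> after the reduction centres the residues at 0, so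
    that |j|/N is itself a distance to the nearest integer.\<close>
  define j where "j i = (t + int i * a + m) mod int N - m" for i :: nat
  have inj: "inj_on j {..<N}"
  proof (rule inj_onI)
    fix i i' assume i: "i \<in> {..<N}" "i' \<in> {..<N}" and "j i = j i'"
    then have "(t + int i * a + m) mod int N = (t + int i' * a + m) mod int N" by (simp add: j_def)
    then have "int N dvd (t + int i * a + m) - (t + int i' * a + m)" by (simp add: mod_eq_dvd_iff)
    then have "int N dvd (int i - int i') * a" by (simp add: algebra_simps)
    then have "int N dvd int i - int i'"
      using cop by (simp add: coprime_dvd_mult_left_iff coprime_commute)
    then have "int i mod int N = int i' mod int N" by (simp add: mod_eq_dvd_iff)
    then show "i = i'" using i by simp
  qed
  have sub: "j ` {..<N} \<subseteq> {- m..<int N - m}" using N by (auto simp: j_def)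
  have "bij_betw j {..<N} {- m..<int N - m}"
    unfolding bij_betw_def using inj sub card_image[OF inj]
    by (intro conjI card_subset_eq) auto
  moreover have "(\<bar>of_int (j i)\<bar> - 2) / N \<le> \<bar>centered (\<theta> + real i * \<alpha>)\<bar> \<and>
      \<bar>centered (\<theta> + real i * \<alpha>)\<bar> \<le> (\<bar>of_int (j i)\<bar> + 2) / N" if i: "i < N" for i
  proof -
    define K where "K = (t + int i * a + m) div int N"
    define y where "y = \<theta> + real i * \<alpha>"
    define \<delta> where "\<delta> = y - of_int K - of_int (j i) / N"
    have K: "t + int i * a = j i + int N * K"
      unfolding j_def K_def by (simp add: algebra_simps minus_mult_div_eq_mod)
    have "of_int t + real i * of_int a = of_int (j i) + real N * of_int K"
      using arg_cong[OF K, of real_of_int] by simp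
    then have "(of_int (j i) + real N * of_int K) / N = (of_int t + real i * of_int a) / N" by simp
    then have "of_int (j i) / N + of_int K = of_int t / N + real i * (of_int a / N)"
      using N by (simp add: add_divide_distrib)
    then have \<delta>_eq: "\<delta> = (\<theta> - of_int t / N) + real i * (\<alpha> - of_int a / N)"
      unfolding \<delta>_def y_def by (simp add: algebra_simps)
    have t1: "0 \<le> \<theta> - of_int t / N" "\<theta> - of_int t / N \<le> 1 / N"
    proof -
      have "of_int t / N \<le> \<theta>" using N by (simp add: t_def pos_divide_le_eq)
      moreover have "\<theta> * N \<le> of_int t + 1" unfolding t_def by linarith
      then have "\<theta> \<le> (of_int t + 1) / N" using N by (simp add: pos_le_divide_eq)
      ultimately show "0 \<le> \<theta> - of_int t / N" "\<theta> - of_int t / N \<le> 1 / N"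
        by (auto simp: add_divide_distrib)
    qed
    have "\<bar>real i * (\<alpha> - of_int a / N)\<bar> \<le> real N * (1 / (real N)\<^sup>2)"
      unfolding abs_mult using i appr by (intro mult_mono) auto
    also have "\<dots> = 1 / N" using N by (simp add: power2_eq_square)
    finally have "\<bar>\<delta>\<bar> \<le> 1 / N + 1 / N" using t1 unfolding \<delta>_eq
      by (intro order_trans[OF abs_triangle_ineq add_mono]) auto
    then have \<delta>: "\<bar>\<delta>\<bar> \<le> 2 / N" by simp
    have jb: "2 * \<bar>j i\<bar> \<le> int N" using sub i unfolding m_def by force
    have "\<bar>centered y\<bar> \<le> \<bar>y - of_int K\<bar>" by (rule abs_centered_le)
    also have "\<dots> \<le> \<bar>of_int (j i) / N\<bar> + \<bar>\<delta>\<bar>" unfolding \<delta>_def by linarith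
    also have "\<dots> \<le> (\<bar>of_int (j i)\<bar> + 2) / N" using \<delta> by (simp add: add_divide_distrib)
    finally have upper: "\<bar>centered y\<bar> \<le> (\<bar>of_int (j i)\<bar> + 2) / N" .
    obtain k where k: "centered y = y - of_int k" by (rule centered_eqE)
    have "\<bar>of_int (j i) / real N\<bar> - 2 / N \<le> \<bar>centered y\<bar>"
    \<comment> \<open>A nearest integer other than \<open>K\<close> is at least 1 away from
      \<open>K\<close>, and 1 - |j|/N - 2/N is no smaller than |j|/N - 2/N because |j|/N \<le>
      1/2.\<close>
    proof (cases "k = K")
      case True
      then show ?thesis using k \<delta> unfolding \<delta>_def by linarith
    next
      case False
      then have "1 \<le> \<bar>of_int k - of_int K :: real\<bar>" by linarith
      moreover have "2 * \<bar>of_int (j i) / real N\<bar> \<le> 1"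
      proof -
        have "real_of_int (2 * \<bar>j i\<bar>) \<le> real_of_int (int N)" using jb by (simp only: of_int_le_iff)
        then show ?thesis using N by (simp add: abs_divide)
      qed
      ultimately show ?thesis using k \<delta> unfolding \<delta>_def by linarith
    qed
    then have "(\<bar>of_int (j i)\<bar> - 2) / N \<le> \<bar>centered y\<bar>" by (simp add: diff_divide_distrib)
    with upper show ?thesis by (simp add: y_def)
  qed
  ultimately show ?thesis unfolding m_def by blast
qed

lemma sum_reciprocal_shift_le_harm: "(\<Sum>k\<in>{3..m}. 1 / (real k - 2)) \<le> harm m"
proof -
  have "(\<Sum>k\<in>{3..m}. 1 / (real k - 2)) = (\<Sum>k\<in>{1..m-2}. 1 / real k)"
    by (rule sum.reindex_bij_witness[of _ "\<lambda>k. k + 2" "\<lambda>k. k - 2"]) auto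
  also have "\<dots> \<le> (\<Sum>k\<in>{1..m}. 1 / real k)" by (rule sum_mono2) auto
  finally show ?thesis by (simp add: harm_def inverse_eq_divide)
qed

lemma sum_reciprocal_shift_ge_ln: "ln (real m) - 2 \<le> (\<Sum>k\<in>{1..m}. 1 / (real k + 2))"
proof -
  have eq: "{1..m+2} = insert 1 (insert 2 {3..m+2})" by auto
  have "harm (m + 2) = 3 / 2 + (\<Sum>k\<in>{3..m+2}. 1 / real k)"
    unfolding harm_def eq by (simp add: inverse_eq_divide)
  also have "(\<Sum>k\<in>{3..m+2}. 1 / real k) = (\<Sum>k\<in>{1..m}. 1 / (real k + 2))"
    by (rule sum.reindex_bij_witness[of _ "\<lambda>k. k + 2" "\<lambda>k. k - 2"]) auto
  finally have "harm (m + 2) = 3 / 2 + (\<Sum>k\<in>{1..m}. 1 / (real k + 2))" .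
  moreover have "ln (real m) \<le> harm (m + 2)"
  proof (cases "m = 0")
    case True then show ?thesis by (simp add: harm_nonneg)
  next
    case False
    then have "ln (real m) \<le> ln (real (m + 2) + 1)" by (subst ln_le_cancel_iff) auto
    then show ?thesis using harm_ge_ln[of "m + 2"] by linarith
  qed
  ultimately show ?thesis by linarith
qed

text \<open>Away from 0 the grid yields two harmonic sums of N ln N each. For |j| \<le> 2 its lower
  bound is not positive, and \<open>sep\<close> bounds each term by N \<psi>; three indices on
  either side, 0 being counted twice, give 6 N \<psi>. The 8 comes from below: each side loses 2 N
  in the harmonic sum and 2 N in passing from ln m to ln N.\<close>

lemma rotation_reciprocal_sum:
  fixes \<alpha> \<theta> \<psi> :: real and a :: int and N :: nat
  assumes N: "N \<ge> 2" and cop: "coprime a (int N)" and appr: "\<bar>\<alpha> - of_int a / real N\<bar> < 1 / (real N)\<^sup>2"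
    and \<psi>: "\<psi> > 0" and sep: "\<And>i. i < N \<Longrightarrow> \<bar>centered (\<theta> + real i * \<alpha>)\<bar> \<ge> 1 / (N * \<psi>)"
  shows "\<bar>(\<Sum>i<N. 1 / \<bar>centered (\<theta> + real i * \<alpha>)\<bar>) - 2 * N * ln N\<bar> \<le> N * (8 + 6 * \<psi>)"
proof -
  define m where "m = N div 2"
  have m: "m > 0" "real m \<le> N" "real N \<le> 4 * m" using N by (auto simp: m_def)
  obtain j where bij: "bij_betw j {..<N} {- int m..<int N - int m}"
    and j: "\<And>i. i < N \<Longrightarrow> (\<bar>of_int (j i)\<bar> - 2) / N \<le> \<bar>centered (\<theta> + real i * \<alpha>)\<bar>"
      "\<And>i. i < N \<Longrightarrow> \<bar>centered (\<theta> + real i * \<alpha>)\<bar> \<le> (\<bar>of_int (j i)\<bar> + 2) / N"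
  proof -
    have "N > 0" using N by simp
    from rotation_points_near_grid[OF this cop appr, of \<theta>] show ?thesis
      unfolding m_def[symmetric] by (elim exE conjE) (rule that, blast+)
  qed
  let ?J = "{- int m..<int N - int m}"
  let ?S = "\<Sum>i<N. 1 / \<bar>centered (\<theta> + real i * \<alpha>)\<bar>"
  have pos: "\<bar>centered (\<theta> + real i * \<alpha>)\<bar> > 0" if "i < N" for i
  proof -
    have "0 < 1 / (N * \<psi>)" using \<psi> N by simp
    then show ?thesis using sep[OF that] by linarith
  qed
  have reidx: "(\<Sum>i<N. G (nat \<bar>j i\<bar>)) = (\<Sum>k\<in>?J. G (nat \<bar>k\<bar>))" for G :: "nat \<Rightarrow> real"
    by (rule sum.reindex_bij_betw[OF bij])
  \<comment> \<open>Treats the two half-lines separately; 0 may occur only on the nonnegative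
    one.\<close>
  have split: "(\<Sum>k\<in>int ` X \<union> (\<lambda>k. - int k) ` Y. G (nat \<bar>k\<bar>)) = (\<Sum>k\<in>X. G k) + (\<Sum>k\<in>Y. G k)"
    if "finite X" "finite Y" "0 \<notin> Y" for G :: "nat \<Rightarrow> real" and X Y
  proof -
    have "int k \<noteq> - int l" if "l \<in> Y" for k l
      using \<open>0 \<notin> Y\<close> that by (cases "l = 0") auto
    then have "int ` X \<inter> (\<lambda>k. - int k) ` Y = {}" by blast
    then show ?thesis
      using that by (simp add: sum.union_disjoint sum.reindex inj_on_def)
  qed
  \<comment> \<open>The index range contains \<open>m\<close> only for odd \<open>N\<close>. Both
    parities are sandwiched: the nonnegative side runs up to \<open>m\<close> in the upper bound and
    stops below \<open>m\<close> in the lower one.\<close>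
  have mN: "int m + int m \<le> int N" "int N - int m \<le> int m + 1" unfolding m_def by auto

  define U where "U k = (if k \<le> 2 then N * \<psi> else N / (real k - 2))" for k :: nat
  have Unn: "U k \<ge> 0" for k using \<psi> by (auto simp: U_def)
  have "?S \<le> (\<Sum>i<N. U (nat \<bar>j i\<bar>))"
  proof (rule sum_mono)
    fix i assume "i \<in> {..<N}" then have i: "i < N" by simp
    show "1 / \<bar>centered (\<theta> + real i * \<alpha>)\<bar> \<le> U (nat \<bar>j i\<bar>)"
    proof (cases "\<bar>j i\<bar> \<le> 2")
      case True
      have "1 / \<bar>centered (\<theta> + real i * \<alpha>)\<bar> \<le> 1 / (1 / (N * \<psi>))"
        using sep[OF i] pos[OF i] \<psi> N by (intro divide_left_mono) auto
      moreover have "nat \<bar>j i\<bar> \<le> 2" using True by linarith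
      ultimately show ?thesis unfolding U_def by simp
    next
      case False
      have "(\<bar>of_int (j i)\<bar> - 2) / N > 0" using False N by (intro divide_pos_pos) auto
      then have "1 / \<bar>centered (\<theta> + real i * \<alpha>)\<bar> \<le> 1 / ((\<bar>of_int (j i)\<bar> - 2) / N)"
        using j(1)[OF i] pos[OF i] by (intro divide_left_mono mult_pos_pos) auto
      moreover have "\<not> nat \<bar>j i\<bar> \<le> 2" using False by linarith
      moreover have "real (nat \<bar>j i\<bar>) = \<bar>of_int (j i)\<bar>" by simp
      ultimately show ?thesis unfolding U_def by simp
    qed
  qed
  also have "\<dots> = (\<Sum>k\<in>?J. U (nat \<bar>k\<bar>))" by (rule reidx)
  also have "\<dots> \<le> (\<Sum>k\<in>int ` {0..m} \<union> (\<lambda>k. - int k) ` {1..m}. U (nat \<bar>k\<bar>))"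
  proof (rule sum_mono2)
    show "?J \<subseteq> int ` {0..m} \<union> (\<lambda>k. - int k) ` {1..m}"
    proof
      fix k assume k: "k \<in> ?J"
      show "k \<in> int ` {0..m} \<union> (\<lambda>k. - int k) ` {1..m}"
      proof (cases "k \<ge> 0")
        case True then show ?thesis using k mN by (auto intro!: image_eqI[of _ int "nat k"])
      next
        case False then show ?thesis using k mN by (auto intro!: image_eqI[of _ "\<lambda>k. - int k" "nat (- k)"])
      qed
    qed
  qed (auto simp: Unn)
  also have "\<dots> = (\<Sum>k\<in>{0..m}. U k) + (\<Sum>k\<in>{1..m}. U k)" by (rule split) auto
  also have "\<dots> \<le> 2 * (\<Sum>k\<in>{0..m}. U k)"
    using sum_mono2[of "{0..m}" "{1..m}" U] Unn by auto
  also have "(\<Sum>k\<in>{0..m}. U k) \<le> 3 * (N * \<psi>) + N * (ln N + 1)"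
  proof -
    have "(\<Sum>k\<in>{0..m}. U k) \<le> (\<Sum>k\<in>{0..2} \<union> {3..m}. U k)"
      using Unn by (intro sum_mono2) auto
    also have "\<dots> = (\<Sum>k\<in>{0..2}. U k) + (\<Sum>k\<in>{3..m}. U k)"
      by (rule sum.union_disjoint) auto
    also have "(\<Sum>k\<in>{0..2}. U k) = 3 * (N * \<psi>)" by (simp add: U_def)
    also have "(\<Sum>k\<in>{3..m}. U k) = N * (\<Sum>k\<in>{3..m}. 1 / (real k - 2))"
      unfolding sum_distrib_left by (rule sum.cong) (auto simp: U_def)
    also have "\<dots> \<le> N * (ln N + 1)"
    proof (rule mult_left_mono)
      have "harm m - ln (real m) \<le> harm 1 - ln (real 1)"
        using m by (intro euler_mascheroni_sequence_decreasing) auto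
      moreover have "ln (real m) \<le> ln (real N)" using m by simp
      ultimately show "(\<Sum>k\<in>{3..m}. 1 / (real k - 2)) \<le> ln N + 1"
        using sum_reciprocal_shift_le_harm[of m] by (simp add: harm_def)
    qed simp
    finally show ?thesis by simp
  qed
  finally have upper: "?S \<le> 2 * (3 * (N * \<psi>) + N * (ln N + 1))" by simp

  define L where "L k = N / (real k + 2)" for k :: nat
  have "N * (ln (real m) - 2) \<le> N * (\<Sum>k\<in>{1..m}. 1 / (real k + 2))"
    by (intro mult_left_mono sum_reciprocal_shift_ge_ln) simp
  also have "\<dots> = (\<Sum>k\<in>{1..m}. L k)" by (simp add: L_def sum_distrib_left)
  finally have L1: "N * (ln (real m) - 2) \<le> (\<Sum>k\<in>{1..m}. L k)" .
  have L2: "(\<Sum>k\<in>{1..m}. L k) \<le> (\<Sum>k\<in>{0..<m}. L k)"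
  proof -
    have "(\<Sum>k\<in>{1..m}. L k) = (\<Sum>k\<in>{0..<m}. L (Suc k))"
      by (rule sum.reindex_bij_witness[of _ Suc "\<lambda>k. k - 1"]) auto
    also have "\<dots> \<le> (\<Sum>k\<in>{0..<m}. L k)"
      by (intro sum_mono) (auto simp: L_def intro!: divide_left_mono)
    finally show ?thesis .
  qed
  have "2 * (N * (ln (real m) - 2)) \<le> (\<Sum>k\<in>{0..<m}. L k) + (\<Sum>k\<in>{1..m}. L k)"
    using L1 L2 by linarith
  also have "\<dots> = (\<Sum>k\<in>int ` {0..<m} \<union> (\<lambda>k. - int k) ` {1..m}. L (nat \<bar>k\<bar>))"
    by (rule split[symmetric]) auto
  also have "\<dots> \<le> (\<Sum>k\<in>?J. L (nat \<bar>k\<bar>))"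
    using mN by (intro sum_mono2) (auto simp: L_def)
  also have "\<dots> = (\<Sum>i<N. L (nat \<bar>j i\<bar>))" by (rule reidx[symmetric])
  also have "\<dots> \<le> ?S"
  proof (rule sum_mono)
    fix i assume "i \<in> {..<N}" then have i: "i < N" by simp
    have "1 / ((\<bar>of_int (j i)\<bar> + 2) / N) \<le> 1 / \<bar>centered (\<theta> + real i * \<alpha>)\<bar>"
      using j(2)[OF i] pos[OF i] N by (intro divide_left_mono mult_pos_pos) auto
    then show "L (nat \<bar>j i\<bar>) \<le> 1 / \<bar>centered (\<theta> + real i * \<alpha>)\<bar>" by (simp add: L_def)
  qed
  finally have lower: "2 * (N * (ln (real m) - 2)) \<le> ?S" .
  have "ln (real N) \<le> ln (4 * real m)" using m N by (subst ln_le_cancel_iff) auto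
  also have "\<dots> = 2 * ln 2 + ln (real m)" using m ln_realpow[of 2 2] by (simp add: ln_mult)
  also have "\<dots> \<le> 2 + ln (real m)" using ln_2_less_1 by simp
  finally have "N * ln (real N) \<le> N * (2 + ln (real m))" by (intro mult_left_mono) auto
  then have "N * ln (real N) \<le> 2 * N + N * ln (real m)" by (simp add: algebra_simps)
  moreover have "2 * (N * ln (real m)) - 4 * N \<le> ?S" using lower by (simp add: algebra_simps)
  moreover have "?S \<le> 6 * (N * \<psi>) + 2 * (N * ln (real N)) + 2 * N"
    using upper by (simp add: algebra_simps)
  moreover have "0 \<le> N * \<psi>" using \<psi> by simp
  ultimately have "\<bar>?S - 2 * (N * ln N)\<bar> \<le> 8 * N + 6 * (N * \<psi>)"
    unfolding abs_le_iff by linarith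
  then show ?thesis by (simp add: distrib_left mult.commute mult.left_commute)
qed

text \<open>Dirichlet: an irrational number has infinitely many reduced fractions with error below
  1/N^2, and their denominators cannot stay bounded.\<close>

lemma rational_approximations_unbounded:
  fixes \<alpha> :: real
  assumes "\<alpha> \<notin> \<rat>"
  shows "\<exists>(N :: nat) a. N > K \<and> coprime a (int N) \<and> \<bar>\<alpha> - of_int a / real N\<bar> < 1 / (real N)\<^sup>2"
proof -
  have "infinite (approx_set \<alpha>)" using assms rational_iff_finite_approx_set by blast
  from infinite_approx_set[OF this, of "int K"] obtain a k where k: "(a, k) \<in> approx_set \<alpha>" "k > int K"
    by blast
  then show ?thesis
    unfolding approx_set_def by (intro exI[of _ "nat k"] exI[of _ a]) (auto simp: coprime_commute)
qed

section \<open>Functions with two nondegenerate zeros\<close>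

definition plane_hessian :: "(real^2 \<Rightarrow> real) \<Rightarrow> real^2 \<Rightarrow> real^2^2" where
  "plane_hessian h P = (\<chi> i j. partial_deriv i (partial_deriv j h) P)"

text \<open>Coordinates adapted to the flow: \<sigma> is the position along (1, \<alpha>), measured
  by the first coordinate, and \<eta> the vertical displacement from the flow line through the
  origin.\<close>

definition line_offset :: "real \<Rightarrow> real \<Rightarrow> real \<Rightarrow> real^2" where
  "line_offset \<alpha> \<sigma> \<eta> = vector [\<sigma>, \<sigma> * \<alpha> + \<eta>]"

lemma line_offset_nth [simp]:
  "line_offset \<alpha> \<sigma> \<eta> $ 1 = \<sigma>" "line_offset \<alpha> \<sigma> \<eta> $ 2 = \<sigma> * \<alpha> + \<eta>"
  by (simp_all add: line_offset_def)

lemma line_offset_eq_0_iff: "line_offset \<alpha> \<sigma> \<eta> = 0 \<longleftrightarrow> \<sigma> = 0 \<and> \<eta> = 0"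
  by (auto simp: vec_eq_iff forall_2)

lemma continuous_on_line_offset [continuous_intros]:
  fixes s e :: "'a::topological_space \<Rightarrow> real"
  assumes "continuous_on S s" "continuous_on S e"
  shows "continuous_on S (\<lambda>x. line_offset \<alpha> (s x) (e x))"
proof -
  have eq: "line_offset \<alpha> \<sigma> \<eta> = \<sigma> *\<^sub>R vector [1, \<alpha>] + \<eta> *\<^sub>R axis 2 1" for \<sigma> \<eta>
    by (auto simp: vec_eq_iff forall_2 axis_def)
  show ?thesis unfolding eq by (intro continuous_intros assms)
qed

lemma quadratic_form_2:
  fixes A :: "real^2^2"
  assumes "transpose A = A"
  shows "vector [x, y] \<bullet> (A *v vector [x, y]) = A$1$1 * x\<^sup>2 + 2 * A$1$2 * x * y + A$2$2 * y\<^sup>2"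
proof -
  have sym: "A$2$1 = A$1$2"
    using arg_cong[OF assms, of "\<lambda>A. A$1$2"] by (simp add: transpose_def)
  show ?thesis unfolding inner_matrix_vector_sum by (simp add: sum_2 sym) algebra
qed

lemma pos_definite_2D:
  assumes "pos_definite A"
  shows "x \<noteq> 0 \<or> y \<noteq> 0 \<Longrightarrow> A$1$1 * x\<^sup>2 + 2 * A$1$2 * x * y + A$2$2 * y\<^sup>2 > 0"
    and "det A = A$1$1 * A$2$2 - (A$1$2)\<^sup>2" and "det A > 0"
proof -
  have tr: "transpose A = A" using assms by (simp add: pos_definite_def)
  have pos: "A$1$1 * x\<^sup>2 + 2 * A$1$2 * x * y + A$2$2 * y\<^sup>2 > 0" if "x \<noteq> 0 \<or> y \<noteq> 0" for x y
  proof -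
    have "(vector [x, y] :: real^2) \<noteq> 0" using that by (auto simp: vec_eq_iff forall_2)
    then show ?thesis using assms unfolding pos_definite_def quadratic_form_2[OF tr, symmetric] by blast
  qed
  then show "x \<noteq> 0 \<or> y \<noteq> 0 \<Longrightarrow> A$1$1 * x\<^sup>2 + 2 * A$1$2 * x * y + A$2$2 * y\<^sup>2 > 0" .
  have sym: "A$2$1 = A$1$2"
    using arg_cong[OF tr, of "\<lambda>A. A$1$2"] by (simp add: transpose_def)
  show det: "det A = A$1$1 * A$2$2 - (A$1$2)\<^sup>2" by (simp add: det_2 sym power2_eq_square)
  have A11: "A$1$1 > 0" using pos[of 1 0] by simp
  \<comment> \<open>The vector (-A12, A11) is chosen because the form takes the value A11 det A
    there.\<close>
  have "A$1$1 * det A = A$1$1 * (- A$1$2)\<^sup>2 + 2 * A$1$2 * (- A$1$2) * A$1$1 + A$2$2 * (A$1$1)\<^sup>2"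
    unfolding det by algebra
  also have "\<dots> > 0" using A11 by (intro pos) simp
  finally show "det A > 0" using A11 by (simp add: zero_less_mult_iff)
qed

text \<open>Passing to the coordinates of \<open>line_offset\<close> is a shear of determinant 1, so
  the discriminant of the form is still \<open>det A\<close> and the crossing constant does not
  involve \<alpha>.\<close>

lemma line_offset_crossing_integral:
  assumes A: "pos_definite A" and a: "0 < a" "a < 1" and "\<epsilon> > 0"
  shows "\<exists>M. \<forall>\<eta>. \<eta> \<noteq> 0 \<longrightarrow> (\<exists>I.
    ((\<lambda>\<sigma>. 2 / (line_offset \<alpha> (\<sigma> - a) \<eta> \<bullet> (A *v line_offset \<alpha> (\<sigma> - a) \<eta>))) has_integral I) {0..1} \<and>
    \<bar>I - 2 * pi / sqrt (det A) / \<bar>\<eta>\<bar>\<bar> \<le> \<epsilon> / \<bar>\<eta>\<bar> + M)"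
proof -
  define a' where "a' = A$1$1 + 2 * \<alpha> * A$1$2 + \<alpha>\<^sup>2 * A$2$2"
  define b' where "b' = A$1$2 + \<alpha> * A$2$2"
  have tr: "transpose A = A" using A by (simp add: pos_definite_def)
  have quad: "line_offset \<alpha> \<sigma> \<eta> \<bullet> (A *v line_offset \<alpha> \<sigma> \<eta>) = a' * \<sigma>\<^sup>2 + 2 * b' * \<sigma> * \<eta> + A$2$2 * \<eta>\<^sup>2" for \<sigma> \<eta>
    unfolding line_offset_def quadratic_form_2[OF tr] a'_def b'_def by algebra
  have a'pos: "a' > 0"
    using pos_definite_2D(1)[OF A, of 1 \<alpha>] by (simp add: a'_def mult_ac)
  have det: "a' * A$2$2 - b'\<^sup>2 = det A"
    unfolding a'_def b'_def pos_definite_2D(2)[OF A] by algebra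
  have "a' * A$2$2 - b'\<^sup>2 > 0" unfolding det by (rule pos_definite_2D(3)[OF A])
  from quadratic_crossing_integral[OF a'pos this a \<open>\<epsilon> > 0\<close>] show ?thesis
    unfolding quad det .
qed

section \<open>Lattice translates and separation on the torus\<close>

lemma torus_rel_refl [simp]: "torus_rel x x"
  by (simp add: torus_rel_def)

lemma torus_rel_sym: "torus_rel x y \<Longrightarrow> torus_rel y x"
  using equivp_torus_rel by (rule equivp_symp)

lemma torus_rel_trans: "torus_rel x y \<Longrightarrow> torus_rel y z \<Longrightarrow> torus_rel x z"
  using equivp_torus_rel by (rule equivp_transp)

text \<open>Displacements from \<open>P\<close> and from \<open>Q\<close> to the same torus point
  together bridge a non-integer coordinate difference, so one of them has at least half its distance
  to the integers. This keeps the two singular neighbourhoods disjoint.\<close>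

lemma torus_separation:
  assumes "\<not> torus_rel P Q"
  shows "\<exists>r>0. \<forall>w w'. torus_rel (P + w) (Q + w') \<longrightarrow> r \<le> norm w \<or> r \<le> norm w'"
proof -
  obtain i where i: "P $ i - Q $ i \<notin> \<int>" using assms by (auto simp: torus_rel_def)
  define \<delta> where "\<delta> = \<bar>centered (P $ i - Q $ i)\<bar>"
  have "\<delta> > 0"
    using i unfolding \<delta>_def centered_def by (metis Ints_of_int eq_iff_diff_eq_0 zero_less_abs_iff)
  moreover have "\<delta> / 2 \<le> norm w \<or> \<delta> / 2 \<le> norm w'" if "torus_rel (P + w) (Q + w')" for w w'
  proof -
    have "(P + w) $ i - (Q + w') $ i \<in> \<int>" using that by (simp only: torus_rel_def)
    then obtain k where "(P + w) $ i - (Q + w') $ i = of_int k" by (rule Ints_cases)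
    then have "\<delta> \<le> \<bar>w' $ i - w $ i\<bar>"
      using abs_centered_le[of "P $ i - Q $ i" k] unfolding \<delta>_def by simp
    also have "\<dots> \<le> norm w + norm w'"
      using component_le_norm_cart[of w i] component_le_norm_cart[of w' i] by linarith
    finally show ?thesis by linarith
  qed
  ultimately show ?thesis by (intro exI[of _ "\<delta> / 2"]) auto
qed

text \<open>The bound on \<sigma> excludes translates in the first coordinate; with \<sigma> = 0, an
  integer \<eta> of size at most 1/2 is left. Hence a unit segment meets a stopping point only at
  offset 0.\<close>

lemma line_offset_torus_rel_0:
  assumes "torus_rel (P + line_offset \<alpha> \<sigma> \<eta>) P" "\<bar>\<sigma>\<bar> < 1" "\<bar>\<eta>\<bar> \<le> 1/2"
  shows "line_offset \<alpha> \<sigma> \<eta> = 0"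
proof -
  have "\<sigma> \<in> \<int>" "\<sigma> * \<alpha> + \<eta> \<in> \<int>"
    using assms(1) by (auto simp: torus_rel_def forall_2)
  then have \<sigma>: "\<sigma> = 0" using assms(2) Ints_nonzero_abs_less1 by blast
  then have "\<eta> \<in> \<int>" using \<open>\<sigma> * \<alpha> + \<eta> \<in> \<int>\<close> by simp
  then have "\<eta> = 0" using assms(3) Ints_nonzero_abs_less1[of \<eta>] by force
  with \<sigma> show ?thesis by (simp add: line_offset_eq_0_iff)
qed

text \<open>The speed function lifted to the plane, where derivatives are taken. \<open>P\<close>
  and \<open>Q\<close> are fixed representatives; their translates enter only through
  \<open>torus_rel\<close>.\<close>

locale two_stopping_points =
  fixes h :: "real^2 \<Rightarrow> real" and P Q :: "real^2"
  assumes C2: "C_k 2 h"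
    and nonneg: "\<And>x. 0 \<le> h x"
    and periodic: "\<And>x y. torus_rel x y \<Longrightarrow> h x = h y"
    and zero_iff: "\<And>x. h x = 0 \<longleftrightarrow> torus_rel x P \<or> torus_rel x Q"
    and distinct: "\<not> torus_rel P Q"
    and pdP: "pos_definite (plane_hessian h P)"
    and pdQ: "pos_definite (plane_hessian h Q)"
begin

text \<open>The reciprocal of the leading term of \<open>h\<close> at \<open>R\<close>; the 2
  inverts the Taylor factor 1/2.\<close>

definition kernel :: "real^2 \<Rightarrow> real^2 \<Rightarrow> real" where
  "kernel R w = 2 / (w \<bullet> (plane_hessian h R *v w))"

lemma continuous_h: "continuous_on UNIV h"
  using C_k_SucD[of 0 h] C_k_SucD[of 1 h] C2 by (simp add: numeral_2_eq_2)

lemma kernel_bounds: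
  assumes "pos_definite (plane_hessian h R)"
  shows "0 \<le> kernel R w" and "r > 0 \<Longrightarrow> \<exists>K\<ge>0. \<forall>w. r \<le> norm w \<longrightarrow> kernel R w \<le> K"
proof -
  obtain c where c: "c > 0" "\<And>w. w \<bullet> (plane_hessian h R *v w) \<ge> c * (norm w)\<^sup>2"
    using pos_definite_lower_bound[OF assms] by blast
  have "0 \<le> w \<bullet> (plane_hessian h R *v w)"
    using c(1) by (intro order_trans[OF _ c(2)]) auto
  then show "0 \<le> kernel R w" by (simp add: kernel_def)
  assume r: "r > 0"
  show "\<exists>K\<ge>0. \<forall>w. r \<le> norm w \<longrightarrow> kernel R w \<le> K"
  proof (intro exI conjI allI impI)
    show "0 \<le> 2 / (c * r\<^sup>2)" using c(1) by simp
    fix w :: "real^2" assume w: "r \<le> norm w"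
    have "c * r\<^sup>2 \<le> w \<bullet> (plane_hessian h R *v w)"
      using c w r by (intro order_trans[OF _ c(2)] mult_left_mono power_mono) auto
    then show "kernel R w \<le> 2 / (c * r\<^sup>2)"
      unfolding kernel_def using c(1) r by (intro divide_left_mono mult_pos_pos) (auto intro: less_le_trans[of 0 "c * r\<^sup>2"])
  qed
qed

text \<open>Compactness. A point is recorded with its offsets from both \<open>P\<close> and
  \<open>Q\<close>; since the integers are closed, compatibility of the two records is a closed
  condition, and \<open>h\<close> has no zero on the resulting compact set.\<close>

lemma quotient_bounded_away:
  assumes f: "continuous_on UNIV f" and ab: "0 < a" "a < 1" "0 < b" "b < 1" and r: "r > 0"
  shows "\<exists>M. \<forall>\<sigma>\<in>{0..1}. \<forall>\<eta>\<in>{-1/2..1/2}. \<forall>\<eta>'\<in>{-1/2..1/2}.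
    torus_rel (P + line_offset \<alpha> (\<sigma> - a) \<eta>) (Q + line_offset \<alpha> (\<sigma> - b) \<eta>') \<longrightarrow>
    r \<le> norm (line_offset \<alpha> (\<sigma> - a) \<eta>) \<longrightarrow> r \<le> norm (line_offset \<alpha> (\<sigma> - b) \<eta>') \<longrightarrow>
    \<bar>f (P + line_offset \<alpha> (\<sigma> - a) \<eta>) / h (P + line_offset \<alpha> (\<sigma> - a) \<eta>)\<bar> \<le> M"
proof -
  define w where "w z = line_offset \<alpha> (fst z - a) (fst (snd z))" for z :: "real \<times> real \<times> real"
  define w' where "w' z = line_offset \<alpha> (fst z - b) (snd (snd z))" for z :: "real \<times> real \<times> real"
  have cont [continuous_intros]: "continuous_on S w" "continuous_on S w'" for S
    unfolding w_def w'_def by (intro continuous_intros)+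
  define C where "C = ({0..1} \<times> {-1/2..1/2} \<times> {-1/2..1/2}) \<inter> ({z. r \<le> norm (w z)} \<inter> {z. r \<le> norm (w' z)}
     \<inter> (\<Inter>i. (\<lambda>z. (P + w z) $ i - (Q + w' z) $ i) -` \<int>))"
  have "closed ({z. r \<le> norm (w z)} \<inter> {z. r \<le> norm (w' z)}
     \<inter> (\<Inter>i. (\<lambda>z. (P + w z) $ i - (Q + w' z) $ i) -` \<int>))"
    by (intro closed_Int closed_Collect_le closed_INT ballI closed_vimage continuous_intros closed_Ints)
  then have "compact C" unfolding C_def by (intro compact_Int_closed compact_Times compact_Icc)
  moreover have nz: "h (P + w z) \<noteq> 0" if z: "z \<in> C" for z
  proof
    have box: "0 \<le> fst z" "fst z \<le> 1" "\<bar>fst (snd z)\<bar> \<le> 1/2" "\<bar>snd (snd z)\<bar> \<le> 1/2"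
      using z by (auto simp: C_def abs_le_iff)
    have rel: "torus_rel (P + w z) (Q + w' z)" using z by (auto simp: C_def torus_rel_def)
    have nw: "w z \<noteq> 0" "w' z \<noteq> 0" using z r by (auto simp: C_def)
    assume "h (P + w z) = 0"
    then consider "torus_rel (P + w z) P" | "torus_rel (Q + w' z) Q"
      using zero_iff rel torus_rel_sym torus_rel_trans by metis
    then show False
    proof cases
      case 1
      then have "w z = 0" unfolding w_def using box ab by (intro line_offset_torus_rel_0) auto
      with nw show False by simp
    next
      case 2
      then have "w' z = 0" unfolding w'_def using box ab by (intro line_offset_torus_rel_0) auto
      with nw show False by simp
    qed
  qed
  have "continuous_on C (\<lambda>z. f (P + w z) / h (P + w z))"
    using nz by (auto intro!: continuous_intros continuous_on_compose2[OF f] continuous_on_compose2[OF continuous_h])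
  ultimately have "bounded ((\<lambda>z. f (P + w z) / h (P + w z)) ` C)"
    by (intro compact_imp_bounded compact_continuous_image)
  then obtain M where M: "\<And>z. z \<in> C \<Longrightarrow> \<bar>f (P + w z) / h (P + w z)\<bar> \<le> M"
    unfolding bounded_iff by auto
  show ?thesis
  proof (intro exI ballI impI)
    fix \<sigma> \<eta> \<eta>' :: real
    assume "\<sigma> \<in> {0..1}" "\<eta> \<in> {-1/2..1/2}" "\<eta>' \<in> {-1/2..1/2}"
      "torus_rel (P + line_offset \<alpha> (\<sigma> - a) \<eta>) (Q + line_offset \<alpha> (\<sigma> - b) \<eta>')"
      "r \<le> norm (line_offset \<alpha> (\<sigma> - a) \<eta>)" "r \<le> norm (line_offset \<alpha> (\<sigma> - b) \<eta>')"
    then have "(\<sigma>, \<eta>, \<eta>') \<in> C"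
      by (auto simp: C_def w_def w'_def torus_rel_def)
    from M[OF this] show "\<bar>f (P + line_offset \<alpha> (\<sigma> - a) \<eta>) / h (P + line_offset \<alpha> (\<sigma> - a) \<eta>)\<bar> \<le> M"
      by (simp add: w_def)
  qed
qed

text \<open>Three regions: near \<open>P\<close>, near \<open>Q\<close>, away from both. Near one
  stopping point the kernel of the other is bounded and goes into \<open>M\<close>; away from both,
  all terms are bounded.\<close>

lemma quotient_pointwise:
  assumes f: "continuous_on UNIV f" and fper: "\<And>x y. torus_rel x y \<Longrightarrow> f x = f y"
    and ab: "0 < a" "a < 1" "0 < b" "b < 1" and \<epsilon>: "\<epsilon> > 0"
  shows "\<exists>M. \<forall>\<sigma>\<in>{0..1}. \<forall>\<eta>\<in>{-1/2..1/2}. \<forall>\<eta>'\<in>{-1/2..1/2}.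
    \<eta> \<noteq> 0 \<longrightarrow> \<eta>' \<noteq> 0 \<longrightarrow>
    torus_rel (P + line_offset \<alpha> (\<sigma> - a) \<eta>) (Q + line_offset \<alpha> (\<sigma> - b) \<eta>') \<longrightarrow>
    \<bar>f (P + line_offset \<alpha> (\<sigma> - a) \<eta>) / h (P + line_offset \<alpha> (\<sigma> - a) \<eta>)
      - f P * kernel P (line_offset \<alpha> (\<sigma> - a) \<eta>) - f Q * kernel Q (line_offset \<alpha> (\<sigma> - b) \<eta>')\<bar>
    \<le> \<epsilon> * (kernel P (line_offset \<alpha> (\<sigma> - a) \<eta>) + kernel Q (line_offset \<alpha> (\<sigma> - b) \<eta>')) + M"
proof -
  have hP: "h P = 0" "h Q = 0" by (simp_all add: zero_iff)
  obtain r0 where r0: "r0 > 0" "\<And>w w'. torus_rel (P + w) (Q + w') \<Longrightarrow> r0 \<le> norm w \<or> r0 \<le> norm w'"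
    using torus_separation[OF distinct] by blast
  obtain r1 where r1: "r1 > 0" "\<And>w. w \<noteq> 0 \<Longrightarrow> norm w < r1 \<Longrightarrow>
      \<bar>f (P + w) / h (P + w) - f P * kernel P w\<bar> \<le> \<epsilon> * kernel P w"
    using local_asymptotics[OF C2 hP(1) nonneg plane_hessian_def pdP f \<epsilon>] unfolding kernel_def by blast
  obtain r2 where r2: "r2 > 0" "\<And>w. w \<noteq> 0 \<Longrightarrow> norm w < r2 \<Longrightarrow>
      \<bar>f (Q + w) / h (Q + w) - f Q * kernel Q w\<bar> \<le> \<epsilon> * kernel Q w"
    using local_asymptotics[OF C2 hP(2) nonneg plane_hessian_def pdQ f \<epsilon>] unfolding kernel_def by blast
  \<comment> \<open>\<open>r0\<close> rules out being near both points at once; \<open>r1\<close>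
    and \<open>r2\<close> are the ranges of the two local expansions.\<close>
  define r where "r = min r0 (min r1 r2)"
  have r: "r > 0" "r \<le> r0" "r \<le> r1" "r \<le> r2" using r0 r1 r2 by (auto simp: r_def)
  obtain KP where KP: "KP \<ge> 0" "\<And>w. r \<le> norm w \<Longrightarrow> kernel P w \<le> KP"
    using kernel_bounds(2)[OF pdP r(1)] by blast
  obtain KQ where KQ: "KQ \<ge> 0" "\<And>w. r \<le> norm w \<Longrightarrow> kernel Q w \<le> KQ"
    using kernel_bounds(2)[OF pdQ r(1)] by blast
  obtain M where M: "\<forall>\<sigma>\<in>{0..1}. \<forall>\<eta>\<in>{-1/2..1/2}. \<forall>\<eta>'\<in>{-1/2..1/2}.
    torus_rel (P + line_offset \<alpha> (\<sigma> - a) \<eta>) (Q + line_offset \<alpha> (\<sigma> - b) \<eta>') \<longrightarrow>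
    r \<le> norm (line_offset \<alpha> (\<sigma> - a) \<eta>) \<longrightarrow> r \<le> norm (line_offset \<alpha> (\<sigma> - b) \<eta>') \<longrightarrow>
    \<bar>f (P + line_offset \<alpha> (\<sigma> - a) \<eta>) / h (P + line_offset \<alpha> (\<sigma> - a) \<eta>)\<bar> \<le> M"
    using quotient_bounded_away[OF f ab r(1)] by blast
  define M' where "M' = max M 0 + \<bar>f P\<bar> * KP + \<bar>f Q\<bar> * KQ"
  have absK: "\<bar>f P * kernel P w\<bar> \<le> \<bar>f P\<bar> * KP" "\<bar>f Q * kernel Q w\<bar> \<le> \<bar>f Q\<bar> * KQ" if "r \<le> norm w" for w
    using KP(2)[OF that] KQ(2)[OF that] kernel_bounds(1)[OF pdP, of w] kernel_bounds(1)[OF pdQ, of w]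
    by (auto simp: abs_mult intro!: mult_left_mono)
  have Knn: "\<bar>f P\<bar> * KP \<ge> 0" "\<bar>f Q\<bar> * KQ \<ge> 0" using KP(1) KQ(1) by auto
  show ?thesis
  proof (intro exI[of _ M'] ballI impI)
    fix \<sigma> \<eta> \<eta>' :: real
    assume s: "\<sigma> \<in> {0..1}" "\<eta> \<in> {-1/2..1/2}" "\<eta>' \<in> {-1/2..1/2}" and nz: "\<eta> \<noteq> 0" "\<eta>' \<noteq> 0"
      and rel: "torus_rel (P + line_offset \<alpha> (\<sigma> - a) \<eta>) (Q + line_offset \<alpha> (\<sigma> - b) \<eta>')"
    define w where "w = line_offset \<alpha> (\<sigma> - a) \<eta>"
    define w' where "w' = line_offset \<alpha> (\<sigma> - b) \<eta>'"
    have w0: "w \<noteq> 0" "w' \<noteq> 0" using nz by (auto simp: w_def w'_def line_offset_eq_0_iff)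
    have rel': "torus_rel (P + w) (Q + w')" using rel by (simp add: w_def w'_def)
    have swap: "f (P + w) / h (P + w) = f (Q + w') / h (Q + w')"
      using periodic[OF rel'] fper[OF rel'] by simp
    have kn: "\<epsilon> * kernel P w \<ge> 0" "\<epsilon> * kernel Q w' \<ge> 0"
      using \<epsilon> kernel_bounds(1)[OF pdP] kernel_bounds(1)[OF pdQ] by auto
    have "\<bar>f (P + w) / h (P + w) - f P * kernel P w - f Q * kernel Q w'\<bar>
        \<le> \<epsilon> * kernel P w + \<epsilon> * kernel Q w' + M'"
    proof (cases "norm w < r")
      case True
      then have "r \<le> norm w'" using r0(2)[OF rel'] r by linarith
      from absK(2)[OF this] show ?thesis
        using r1(2)[OF w0(1)] True r(3) kn Knn unfolding M'_def by linarith
    next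
      case False
      show ?thesis
      proof (cases "norm w' < r")
        case True
        then show ?thesis
          using r2(2)[OF w0(2)] absK(1)[of w] False r(4) kn Knn unfolding M'_def swap by linarith
      next
        case False': False
        have "\<bar>f (P + w) / h (P + w)\<bar> \<le> M"
          using M s rel False False' unfolding w_def w'_def not_less by blast
        then show ?thesis
          using absK(1)[of w] absK(2)[of w'] False False' kn unfolding M'_def by linarith
      qed
    qed
    then show "\<bar>f (P + line_offset \<alpha> (\<sigma> - a) \<eta>) / h (P + line_offset \<alpha> (\<sigma> - a) \<eta>)
      - f P * kernel P (line_offset \<alpha> (\<sigma> - a) \<eta>) - f Q * kernel Q (line_offset \<alpha> (\<sigma> - b) \<eta>')\<bar>
    \<le> \<epsilon> * (kernel P (line_offset \<alpha> (\<sigma> - a) \<eta>) + kernel Q (line_offset \<alpha> (\<sigma> - b) \<eta>')) + M'"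
      by (simp add: w_def w'_def distrib_left)
  qed
qed

definition crossing_const :: "real^2 \<Rightarrow> real" where
  "crossing_const R = 2 * pi / sqrt (det (plane_hessian h R))"

section \<open>Integrals of \<open>f / h\<close> along one orbit\<close>

context
  fixes \<alpha> a b :: real and X :: "real^2"
  assumes ab: "0 < a" "a < 1" "0 < b" "b < 1"
    and aP: "X $ 1 + a - P $ 1 \<in> \<int>" and bQ: "X $ 1 + b - Q $ 1 \<in> \<int>"
begin

text \<open>The orbit segment of length one starting at \<open>X + i (1, \<alpha>)\<close> passes \<open>P\<close> after length \<open>a\<close>,
  at vertical distance \<open>offP i\<close> from the nearest translate of \<open>P\<close>; similarly for \<open>Q\<close> and \<open>b\<close>.\<close>

definition offP :: "nat \<Rightarrow> real" where
  "offP i = centered (X $ 2 + a * \<alpha> - P $ 2 + real i * \<alpha>)"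

definition offQ :: "nat \<Rightarrow> real" where
  "offQ i = centered (X $ 2 + b * \<alpha> - Q $ 2 + real i * \<alpha>)"

text \<open>Every point of a unit segment is described from \<open>P\<close> and from
  \<open>Q\<close> at once. \<open>aP\<close> and \<open>bQ\<close> align the first coordinates up
  to integers, and the rounding in \<open>centered\<close> aligns the second.\<close>

lemma segment_torus_rel:
  "torus_rel (X + line_offset \<alpha> (real i + \<sigma>) 0) (P + line_offset \<alpha> (\<sigma> - a) (offP i))"
  "torus_rel (X + line_offset \<alpha> (real i + \<sigma>) 0) (Q + line_offset \<alpha> (\<sigma> - b) (offQ i))"
proof -
  have off: "offP i = X $ 2 + a * \<alpha> - P $ 2 + real i * \<alpha> - of_int (round (X $ 2 + a * \<alpha> - P $ 2 + real i * \<alpha>))"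
    "offQ i = X $ 2 + b * \<alpha> - Q $ 2 + real i * \<alpha> - of_int (round (X $ 2 + b * \<alpha> - Q $ 2 + real i * \<alpha>))"
    by (simp_all only: offP_def offQ_def centered_def)
  have "(X + line_offset \<alpha> (real i + \<sigma>) 0) $ 1 - (P + line_offset \<alpha> (\<sigma> - a) (offP i)) $ 1 = of_int (int i) + (X $ 1 + a - P $ 1)"
    "(X + line_offset \<alpha> (real i + \<sigma>) 0) $ 1 - (Q + line_offset \<alpha> (\<sigma> - b) (offQ i)) $ 1 = of_int (int i) + (X $ 1 + b - Q $ 1)"
    by simp_all
  moreover have "(X + line_offset \<alpha> (real i + \<sigma>) 0) $ 2 - (P + line_offset \<alpha> (\<sigma> - a) (offP i)) $ 2 \<in> \<int>"
    "(X + line_offset \<alpha> (real i + \<sigma>) 0) $ 2 - (Q + line_offset \<alpha> (\<sigma> - b) (offQ i)) $ 2 \<in> \<int>"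
    by (simp_all add: off algebra_simps)
  ultimately show "torus_rel (X + line_offset \<alpha> (real i + \<sigma>) 0) (P + line_offset \<alpha> (\<sigma> - a) (offP i))"
    "torus_rel (X + line_offset \<alpha> (real i + \<sigma>) 0) (Q + line_offset \<alpha> (\<sigma> - b) (offQ i))"
    using aP bQ by (simp_all only: torus_rel_def forall_2 Ints_add Ints_of_int simp_thms)
qed

lemma off_bounds: "offP i \<in> {-1/2..1/2}" "offQ i \<in> {-1/2..1/2}"
  using abs_centered_le_half[of "X $ 2 + a * \<alpha> - P $ 2 + real i * \<alpha>"]
    abs_centered_le_half[of "X $ 2 + b * \<alpha> - Q $ 2 + real i * \<alpha>"]
  unfolding offP_def offQ_def abs_le_iff by auto

lemma segment_h_nonzero:
  assumes "offP i \<noteq> 0" "offQ i \<noteq> 0" "\<sigma> \<in> {0..1}"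
  shows "h (X + line_offset \<alpha> (real i + \<sigma>) 0) \<noteq> 0"
proof
  assume "h (X + line_offset \<alpha> (real i + \<sigma>) 0) = 0"
  then have "torus_rel (X + line_offset \<alpha> (real i + \<sigma>) 0) P \<or> torus_rel (X + line_offset \<alpha> (real i + \<sigma>) 0) Q"
    by (simp only: zero_iff)
  then show False
  proof
    assume "torus_rel (X + line_offset \<alpha> (real i + \<sigma>) 0) P"
    with torus_rel_sym[OF segment_torus_rel(1)]
    have rel: "torus_rel (P + line_offset \<alpha> (\<sigma> - a) (offP i)) P" by (rule torus_rel_trans)
    have "\<bar>\<sigma> - a\<bar> < 1" using assms(3) ab by auto
    moreover have "\<bar>offP i\<bar> \<le> 1/2" using off_bounds(1)[of i] by auto
    ultimately have "line_offset \<alpha> (\<sigma> - a) (offP i) = 0" by (rule line_offset_torus_rel_0[OF rel])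
    then show False using assms(1) by (simp add: line_offset_eq_0_iff)
  next
    assume "torus_rel (X + line_offset \<alpha> (real i + \<sigma>) 0) Q"
    with torus_rel_sym[OF segment_torus_rel(2)]
    have rel: "torus_rel (Q + line_offset \<alpha> (\<sigma> - b) (offQ i)) Q" by (rule torus_rel_trans)
    have "\<bar>\<sigma> - b\<bar> < 1" using assms(3) ab by auto
    moreover have "\<bar>offQ i\<bar> \<le> 1/2" using off_bounds(2)[of i] by auto
    ultimately have "line_offset \<alpha> (\<sigma> - b) (offQ i) = 0" by (rule line_offset_torus_rel_0[OF rel])
    then show False using assms(2) by (simp add: line_offset_eq_0_iff)
  qed
qed

lemma orbit_h_nonzero:
  assumes "\<And>i. i < N \<Longrightarrow> offP i \<noteq> 0" "\<And>i. i < N \<Longrightarrow> offQ i \<noteq> 0" "s \<in> {0..real N}" "N > 0"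
  shows "h (X + line_offset \<alpha> s 0) \<noteq> 0"
proof -
  \<comment> \<open>Capping at N - 1 makes s = N the end \<sigma> = 1 of the last segment.\<close>
  define i where "i = min (nat \<lfloor>s\<rfloor>) (N - 1)"
  have "i < N" using assms(4) by (simp add: i_def)
  moreover have "s - real i \<in> {0..1}"
  proof (cases "s = real N")
    case True
    then show ?thesis using assms(4) by (simp add: i_def)
  next
    case False
    then have "nat \<lfloor>s\<rfloor> \<le> N - 1" using assms(3,4) by (simp add: nat_le_iff floor_le_iff) linarith
    then have "i = nat \<lfloor>s\<rfloor>" by (simp add: i_def)
    then show ?thesis using assms(3) by simp linarith
  qed
  ultimately show ?thesis using segment_h_nonzero[of i "s - real i"] assms(1,2) by simp
qed

text \<open>Integrates \<open>quotient_pointwise\<close> over one segment, each kernel contributing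
  its crossing time. That \<open>M\<close> is the same for all segments is what permits summing over
  \<open>i\<close>.\<close>

lemma segment_integral:
  fixes f :: "real^2 \<Rightarrow> real"
  assumes f: "continuous_on UNIV f" and fper: "\<And>x y. torus_rel x y \<Longrightarrow> f x = f y" and \<epsilon>: "\<epsilon> > 0"
  shows "\<exists>M. \<forall>i. offP i \<noteq> 0 \<longrightarrow> offQ i \<noteq> 0 \<longrightarrow>
    \<bar>integral {0..1} (\<lambda>\<sigma>. f (X + line_offset \<alpha> (real i + \<sigma>) 0) / h (X + line_offset \<alpha> (real i + \<sigma>) 0))
      - f P * crossing_const P * (1 / \<bar>offP i\<bar>) - f Q * crossing_const Q * (1 / \<bar>offQ i\<bar>)\<bar>
    \<le> \<epsilon> * (1 / \<bar>offP i\<bar> + 1 / \<bar>offQ i\<bar>) + M"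
proof -
  define Fm where "Fm = \<bar>f P\<bar> + \<bar>f Q\<bar>"
  define c where "c = \<bar>crossing_const P\<bar> + \<bar>crossing_const Q\<bar>"
  \<comment> \<open>Two error budgets of \<epsilon>/2 each. \<open>\<epsilon>2\<close> is the error
    of the kernel integrals, amplified by the values of \<open>f\<close>; \<open>\<epsilon>1\<close>
    is the pointwise error, amplified by the kernel integrals, which are at most c +
    \<open>\<epsilon>2\<close> per unit of 1/|offset| up to a constant.\<close>
  define \<epsilon>2 where "\<epsilon>2 = \<epsilon> / (2 * (Fm + 1))"
  have Fm: "Fm \<ge> 0" and c: "c \<ge> 0" by (auto simp: Fm_def c_def)
  have \<epsilon>2: "\<epsilon>2 > 0" "Fm * \<epsilon>2 \<le> \<epsilon> / 2"
  proof -
    show "\<epsilon>2 > 0" unfolding \<epsilon>2_def using \<epsilon> Fm by (intro divide_pos_pos) auto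
    have "K * (\<epsilon> / (2 * K)) = \<epsilon> / 2" if "K \<noteq> 0" for K :: real using that by simp
    from this[of "Fm + 1"] have "(Fm + 1) * \<epsilon>2 = \<epsilon> / 2" unfolding \<epsilon>2_def using Fm by linarith
    with \<open>\<epsilon>2 > 0\<close> show "Fm * \<epsilon>2 \<le> \<epsilon> / 2" by (simp add: distrib_right)
  qed
  define \<epsilon>1 where "\<epsilon>1 = \<epsilon> / (2 * (c + \<epsilon>2))"
  have \<epsilon>1: "\<epsilon>1 > 0" "\<epsilon>1 * (c + \<epsilon>2) = \<epsilon> / 2"
  proof -
    have K: "c + \<epsilon>2 > 0" using c \<epsilon>2(1) by linarith
    then show "\<epsilon>1 > 0" unfolding \<epsilon>1_def using \<epsilon> by (intro divide_pos_pos) auto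
    have "\<epsilon> / (2 * K) * K = \<epsilon> / 2" if "K \<noteq> 0" for K :: real using that by simp
    from this[of "c + \<epsilon>2"] K show "\<epsilon>1 * (c + \<epsilon>2) = \<epsilon> / 2" unfolding \<epsilon>1_def by linarith
  qed
  obtain M1 where M1: "\<forall>\<sigma>\<in>{0..1}. \<forall>\<eta>\<in>{-1/2..1/2}. \<forall>\<eta>'\<in>{-1/2..1/2}.
    \<eta> \<noteq> 0 \<longrightarrow> \<eta>' \<noteq> 0 \<longrightarrow>
    torus_rel (P + line_offset \<alpha> (\<sigma> - a) \<eta>) (Q + line_offset \<alpha> (\<sigma> - b) \<eta>') \<longrightarrow>
    \<bar>f (P + line_offset \<alpha> (\<sigma> - a) \<eta>) / h (P + line_offset \<alpha> (\<sigma> - a) \<eta>)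
      - f P * kernel P (line_offset \<alpha> (\<sigma> - a) \<eta>) - f Q * kernel Q (line_offset \<alpha> (\<sigma> - b) \<eta>')\<bar>
    \<le> \<epsilon>1 * (kernel P (line_offset \<alpha> (\<sigma> - a) \<eta>) + kernel Q (line_offset \<alpha> (\<sigma> - b) \<eta>')) + M1"
    using quotient_pointwise[OF f fper ab \<epsilon>1(1)] by blast
  obtain MP where MP: "\<And>\<eta>. \<eta> \<noteq> 0 \<Longrightarrow> \<exists>I. ((\<lambda>\<sigma>. kernel P (line_offset \<alpha> (\<sigma> - a) \<eta>)) has_integral I) {0..1} \<and>
      \<bar>I - crossing_const P / \<bar>\<eta>\<bar>\<bar> \<le> \<epsilon>2 / \<bar>\<eta>\<bar> + MP"
    using line_offset_crossing_integral[OF pdP ab(1,2) \<epsilon>2(1)] unfolding kernel_def crossing_const_def by blast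
  obtain MQ where MQ: "\<And>\<eta>. \<eta> \<noteq> 0 \<Longrightarrow> \<exists>I. ((\<lambda>\<sigma>. kernel Q (line_offset \<alpha> (\<sigma> - b) \<eta>)) has_integral I) {0..1} \<and>
      \<bar>I - crossing_const Q / \<bar>\<eta>\<bar>\<bar> \<le> \<epsilon>2 / \<bar>\<eta>\<bar> + MQ"
    using line_offset_crossing_integral[OF pdQ ab(3,4) \<epsilon>2(1)] unfolding kernel_def crossing_const_def by blast
  define M where "M = M1 + \<epsilon>1 * (MP + MQ) + \<bar>f P\<bar> * MP + \<bar>f Q\<bar> * MQ"
  show ?thesis
  proof (intro exI[of _ M] allI impI)
    fix i assume nz: "offP i \<noteq> 0" "offQ i \<noteq> 0"
    define u where "u \<sigma> = f (X + line_offset \<alpha> (real i + \<sigma>) 0) / h (X + line_offset \<alpha> (real i + \<sigma>) 0)" for \<sigma>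
    define kP where "kP \<sigma> = kernel P (line_offset \<alpha> (\<sigma> - a) (offP i))" for \<sigma>
    define kQ where "kQ \<sigma> = kernel Q (line_offset \<alpha> (\<sigma> - b) (offQ i))" for \<sigma>
    define yP where "yP = 1 / \<bar>offP i\<bar>"
    define yQ where "yQ = 1 / \<bar>offQ i\<bar>"
    have y: "yP \<ge> 0" "yQ \<ge> 0" by (auto simp: yP_def yQ_def)
    obtain IP where IP: "(kP has_integral IP) {0..1}" "\<bar>IP - crossing_const P * yP\<bar> \<le> \<epsilon>2 * yP + MP"
      using MP[OF nz(1)] unfolding kP_def yP_def by auto
    obtain IQ where IQ: "(kQ has_integral IQ) {0..1}" "\<bar>IQ - crossing_const Q * yQ\<bar> \<le> \<epsilon>2 * yQ + MQ"
      using MQ[OF nz(2)] unfolding kQ_def yQ_def by auto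
    have "continuous_on {0..1} u"
      unfolding u_def using segment_h_nonzero[OF nz]
      by (intro continuous_intros continuous_on_compose2[OF f] continuous_on_compose2[OF continuous_h]) auto
    then have u: "(u has_integral integral {0..1} u) {0..1}"
      by (intro integrable_integral integrable_continuous_interval)
    have pw: "\<bar>u \<sigma> - f P * kP \<sigma> - f Q * kQ \<sigma>\<bar> \<le> \<epsilon>1 * (kP \<sigma> + kQ \<sigma>) + M1" if "\<sigma> \<in> {0..1}" for \<sigma>
    proof -
      have "torus_rel (P + line_offset \<alpha> (\<sigma> - a) (offP i)) (Q + line_offset \<alpha> (\<sigma> - b) (offQ i))"
        using segment_torus_rel torus_rel_sym torus_rel_trans by blast
      moreover have "u \<sigma> = f (P + line_offset \<alpha> (\<sigma> - a) (offP i)) / h (P + line_offset \<alpha> (\<sigma> - a) (offP i))"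
        unfolding u_def using fper[OF segment_torus_rel(1)] periodic[OF segment_torus_rel(1)] by simp
      ultimately show ?thesis
        using M1 that off_bounds nz unfolding kP_def kQ_def by simp
    qed
    have D: "((\<lambda>\<sigma>. u \<sigma> - f P * kP \<sigma> - f Q * kQ \<sigma>) has_integral integral {0..1} u - f P * IP - f Q * IQ) {0..1}"
      by (intro has_integral_diff u has_integral_mult_right IP IQ)
    have "((\<lambda>\<sigma>. \<epsilon>1 * (kP \<sigma> + kQ \<sigma>) + M1) has_integral \<epsilon>1 * (IP + IQ) + M1 * (1 - 0)) {0..1}"
      using has_integral_const_real[of M1 0 1]
      by (intro has_integral_add has_integral_mult_right IP IQ) (simp add: mult.commute)
    then have E: "((\<lambda>\<sigma>. \<epsilon>1 * (kP \<sigma> + kQ \<sigma>) + M1) has_integral \<epsilon>1 * (IP + IQ) + M1) {0..1}" by simp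
    have "integral {0..1} u - f P * IP - f Q * IQ \<le> \<epsilon>1 * (IP + IQ) + M1"
      using pw by (intro has_integral_le[OF D E]) (auto simp: abs_le_iff)
    moreover have "- (integral {0..1} u - f P * IP - f Q * IQ) \<le> \<epsilon>1 * (IP + IQ) + M1"
      using pw by (intro has_integral_le[OF has_integral_neg[OF D] E]) (auto simp: abs_le_iff)
    ultimately have main: "\<bar>integral {0..1} u - f P * IP - f Q * IQ\<bar> \<le> \<epsilon>1 * (IP + IQ) + M1" by linarith
    have "f P * IP - f P * crossing_const P * yP = f P * (IP - crossing_const P * yP)"
      "f Q * IQ - f Q * crossing_const Q * yQ = f Q * (IQ - crossing_const Q * yQ)"
      by (simp_all add: algebra_simps)
    then have eP: "\<bar>f P * IP - f P * crossing_const P * yP\<bar> \<le> \<bar>f P\<bar> * (\<epsilon>2 * yP + MP)"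
      and eQ: "\<bar>f Q * IQ - f Q * crossing_const Q * yQ\<bar> \<le> \<bar>f Q\<bar> * (\<epsilon>2 * yQ + MQ)"
      using IP(2) IQ(2) by (auto simp: abs_mult intro!: mult_left_mono)
    have iP: "IP \<le> (c + \<epsilon>2) * yP + MP"
    proof -
      have "crossing_const P * yP \<le> c * yP" unfolding c_def using y by (intro mult_right_mono) auto
      then show ?thesis using IP(2) by (simp add: distrib_right)
    qed
    have iQ: "IQ \<le> (c + \<epsilon>2) * yQ + MQ"
    proof -
      have "crossing_const Q * yQ \<le> c * yQ" unfolding c_def using y by (intro mult_right_mono) auto
      then show ?thesis using IQ(2) by (simp add: distrib_right)
    qed
    have "\<epsilon>1 * (IP + IQ) \<le> \<epsilon>1 * ((c + \<epsilon>2) * (yP + yQ) + (MP + MQ))"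
      using iP iQ \<epsilon>1(1) by (intro mult_left_mono) (auto simp: distrib_left)
    also have "\<dots> = \<epsilon>1 * (c + \<epsilon>2) * (yP + yQ) + \<epsilon>1 * (MP + MQ)"
      by (simp only: distrib_left[of \<epsilon>1 "(c + \<epsilon>2) * (yP + yQ)"] mult.assoc)
    also have "\<dots> = \<epsilon> / 2 * (yP + yQ) + \<epsilon>1 * (MP + MQ)"
      by (simp only: \<epsilon>1(2))
    finally have e1: "\<epsilon>1 * (IP + IQ) \<le> \<epsilon> / 2 * (yP + yQ) + \<epsilon>1 * (MP + MQ)" .
    have "\<bar>f P\<bar> * (\<epsilon>2 * yP) + \<bar>f Q\<bar> * (\<epsilon>2 * yQ) \<le> Fm * (\<epsilon>2 * yP) + Fm * (\<epsilon>2 * yQ)"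
      unfolding Fm_def using y \<epsilon>2(1) by (intro add_mono mult_right_mono) auto
    also have "\<dots> = (Fm * \<epsilon>2) * (yP + yQ)" by (simp add: algebra_simps)
    also have "\<dots> \<le> \<epsilon> / 2 * (yP + yQ)" using \<epsilon>2(2) y by (intro mult_right_mono) auto
    finally have e2: "\<bar>f P\<bar> * (\<epsilon>2 * yP + MP) + \<bar>f Q\<bar> * (\<epsilon>2 * yQ + MQ) \<le>
      \<epsilon> / 2 * (yP + yQ) + \<bar>f P\<bar> * MP + \<bar>f Q\<bar> * MQ" by (simp add: distrib_left)
    have "\<bar>integral {0..1} u - f P * crossing_const P * yP - f Q * crossing_const Q * yQ\<bar>
      \<le> \<epsilon> / 2 * (yP + yQ) + \<epsilon> / 2 * (yP + yQ) + M"
      using main eP eQ e1 e2 unfolding M_def by linarith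
    then show "\<bar>integral {0..1} (\<lambda>\<sigma>. f (X + line_offset \<alpha> (real i + \<sigma>) 0) / h (X + line_offset \<alpha> (real i + \<sigma>) 0))
      - f P * crossing_const P * (1 / \<bar>offP i\<bar>) - f Q * crossing_const Q * (1 / \<bar>offQ i\<bar>)\<bar>
    \<le> \<epsilon> * (1 / \<bar>offP i\<bar> + 1 / \<bar>offQ i\<bar>) + M"
      by (simp add: u_def[abs_def] yP_def yQ_def)
  qed
qed

text \<open>The bounded errors of the segments add up to M N, which is negligible once the
  reciprocal sums are of order N ln N.\<close>

lemma orbit_integral:
  fixes f :: "real^2 \<Rightarrow> real"
  assumes f: "continuous_on UNIV f" and fper: "\<And>x y. torus_rel x y \<Longrightarrow> f x = f y" and \<epsilon>: "\<epsilon> > 0"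
  shows "\<exists>M. \<forall>N. (\<forall>i<N. offP i \<noteq> 0 \<and> offQ i \<noteq> 0) \<longrightarrow>
    \<bar>integral {0..real N} (\<lambda>s. f (X + line_offset \<alpha> s 0) / h (X + line_offset \<alpha> s 0))
      - f P * crossing_const P * (\<Sum>i<N. 1 / \<bar>offP i\<bar>) - f Q * crossing_const Q * (\<Sum>i<N. 1 / \<bar>offQ i\<bar>)\<bar>
    \<le> \<epsilon> * ((\<Sum>i<N. 1 / \<bar>offP i\<bar>) + (\<Sum>i<N. 1 / \<bar>offQ i\<bar>)) + M * real N"
proof -
  define u where "u s = f (X + line_offset \<alpha> s 0) / h (X + line_offset \<alpha> s 0)" for s
  obtain M where M: "\<And>i. offP i \<noteq> 0 \<Longrightarrow> offQ i \<noteq> 0 \<Longrightarrow>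
    \<bar>integral {0..1} (\<lambda>\<sigma>. u (real i + \<sigma>))
      - f P * crossing_const P * (1 / \<bar>offP i\<bar>) - f Q * crossing_const Q * (1 / \<bar>offQ i\<bar>)\<bar>
    \<le> \<epsilon> * (1 / \<bar>offP i\<bar> + 1 / \<bar>offQ i\<bar>) + M"
    using segment_integral[OF f fper \<epsilon>] unfolding u_def by blast
  have cont: "continuous_on {0..real N} u" if "\<forall>i<N. offP i \<noteq> 0 \<and> offQ i \<noteq> 0" for N
  proof (cases "N = 0")
    case False
    then show ?thesis
      unfolding u_def using orbit_h_nonzero[of N] that
      by (intro continuous_intros continuous_on_compose2[OF f] continuous_on_compose2[OF continuous_h]) auto
  qed simp
  have "\<bar>integral {0..real N} u
      - f P * crossing_const P * (\<Sum>i<N. 1 / \<bar>offP i\<bar>) - f Q * crossing_const Q * (\<Sum>i<N. 1 / \<bar>offQ i\<bar>)\<bar>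
    \<le> \<epsilon> * ((\<Sum>i<N. 1 / \<bar>offP i\<bar>) + (\<Sum>i<N. 1 / \<bar>offQ i\<bar>)) + M * real N"
    if "\<forall>i<N. offP i \<noteq> 0 \<and> offQ i \<noteq> 0" for N
    using that
  proof (induction N)
    case 0
    show ?case by simp
  next
    case (Suc N)
    have c: "continuous_on {0..real (Suc N)} u" using cont Suc.prems by blast
    have "integral {0..1} (u \<circ> (\<lambda>\<sigma>. \<sigma> + real N)) = integral {0 + real N..1 + real N} u"
      by (rule integral_shift, rule continuous_on_subset[OF c]) auto
    then have "integral {real N..real (Suc N)} u = integral {0..1} (\<lambda>\<sigma>. u (real N + \<sigma>))"
      by (simp add: o_def add.commute)
    moreover have "integral {0..real N} u + integral {real N..real (Suc N)} u = integral {0..real (Suc N)} u"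
      by (intro Henstock_Kurzweil_Integration.integral_combine integrable_continuous_interval c) auto
    ultimately have eq: "integral {0..real (Suc N)} u = integral {0..real N} u + integral {0..1} (\<lambda>\<sigma>. u (real N + \<sigma>))"
      by simp
    have IH: "\<bar>integral {0..real N} u
      - f P * crossing_const P * (\<Sum>i<N. 1 / \<bar>offP i\<bar>) - f Q * crossing_const Q * (\<Sum>i<N. 1 / \<bar>offQ i\<bar>)\<bar>
      \<le> \<epsilon> * ((\<Sum>i<N. 1 / \<bar>offP i\<bar>) + (\<Sum>i<N. 1 / \<bar>offQ i\<bar>)) + M * real N"
      using Suc by simp
    have nzN: "offP N \<noteq> 0" "offQ N \<noteq> 0" using Suc.prems by auto
    have combine: "\<bar>i + j - p * (x + x') - q * (y + y')\<bar> \<le> \<epsilon> * ((x + x') + (y + y')) + M * real (Suc N)"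
      if "\<bar>i - p * x - q * y\<bar> \<le> \<epsilon> * (x + y) + M * real N" "\<bar>j - p * x' - q * y'\<bar> \<le> \<epsilon> * (x' + y') + M"
      for i j p q x x' y y' :: real
      using that unfolding abs_le_iff of_nat_Suc by (simp add: algebra_simps)
    show ?case
      unfolding eq sum.lessThan_Suc by (rule combine[OF IH M[OF nzN]])
  qed
  then show ?thesis unfolding u_def[abs_def] by (intro exI[of _ M] allI) blast
qed

text \<open>\<open>rotation_reciprocal_sum\<close> with \<psi> = sqrt(ln N), divided by N ln N,
  leaves the error 8 / ln N + 6 / sqrt(ln N). Both normalised sums therefore tend to 2 whatever the
  offsets, and only the crossing constants distinguish \<open>P\<close> from
  \<open>Q\<close>.\<close>

lemma orbit_integral_asymptotics:
  fixes f :: "real^2 \<Rightarrow> real" and n :: "nat \<Rightarrow> nat" and k :: "nat \<Rightarrow> int"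
  assumes f: "continuous_on UNIV f" and fper: "\<And>x y. torus_rel x y \<Longrightarrow> f x = f y"
    and n: "filterlim n at_top sequentially" and n2: "\<And>j. n j \<ge> 2"
    and cop: "\<And>j. coprime (k j) (int (n j))"
    and appr: "\<And>j. \<bar>\<alpha> - of_int (k j) / real (n j)\<bar> < 1 / (real (n j))\<^sup>2"
    and sepP: "\<And>i j. i < n j \<Longrightarrow> \<bar>offP i\<bar> \<ge> 1 / (n j * sqrt (ln (n j)))"
    and sepQ: "\<And>i j. i < n j \<Longrightarrow> \<bar>offQ i\<bar> \<ge> 1 / (n j * sqrt (ln (n j)))"
  shows "(\<lambda>j. integral {0..real (n j)} (\<lambda>s. f (X + line_offset \<alpha> s 0) / h (X + line_offset \<alpha> s 0))
      / (n j * ln (n j))) \<longlonglongrightarrow> 2 * (f P * crossing_const P + f Q * crossing_const Q)"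
proof -
  define D where "D j = real (n j) * ln (n j)" for j
  define L where "L j = sqrt (ln (real (n j)))" for j
  have n2': "real (n j) \<ge> 2" for j using n2[of j] by simp
  have lnpos: "ln (real (n j)) > 0" for j using n2'[of j] by (intro ln_gt_zero) linarith
  have D: "D j > 0" for j using n2'[of j] lnpos[of j] unfolding D_def by (intro mult_pos_pos) linarith+
  have L: "L j > 0" for j using lnpos[of j] by (simp add: L_def)
  have L2: "ln (real (n j)) = L j * L j" for j using lnpos[of j] by (simp add: L_def)
  have limln: "filterlim (\<lambda>j. ln (real (n j))) at_top sequentially"
    by (intro filterlim_compose[OF ln_at_top] filterlim_compose[OF filterlim_real_sequentially] n)
  then have limL: "filterlim L at_top sequentially"
    unfolding L_def by (rule filterlim_compose[OF sqrt_at_top])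
  have small: "(\<lambda>j. 8 / ln (real (n j)) + 6 / L j) \<longlonglongrightarrow> 0 + 0"
    by (intro tendsto_add real_tendsto_divide_at_top[OF tendsto_const] limln limL)
  have sumlim: "(\<lambda>j. (\<Sum>i<n j. 1 / \<bar>centered (\<theta> + real i * \<alpha>)\<bar>) / D j) \<longlonglongrightarrow> 2"
    if sep: "\<And>i j. i < n j \<Longrightarrow> \<bar>centered (\<theta> + real i * \<alpha>)\<bar> \<ge> 1 / (n j * L j)" for \<theta>
  proof (rule LIM_zero_cancel, rule Lim_null_comparison[OF always_eventually])
    show "\<forall>j. norm ((\<Sum>i<n j. 1 / \<bar>centered (\<theta> + real i * \<alpha>)\<bar>) / D j - 2) \<le> 8 / ln (real (n j)) + 6 / L j"
    proof
      fix j
      let ?S = "\<Sum>i<n j. 1 / \<bar>centered (\<theta> + real i * \<alpha>)\<bar>"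
      have "\<bar>?S - 2 * n j * ln (n j)\<bar> \<le> n j * (8 + 6 * L j)"
        by (rule rotation_reciprocal_sum[OF n2 cop appr L sep])
      then have "\<bar>?S - 2 * D j\<bar> / D j \<le> n j * (8 + 6 * L j) / D j"
        using D[of j] by (intro divide_right_mono) (auto simp: D_def mult.assoc)
      also have "n j * (8 + 6 * L j) / D j = (8 + 6 * L j) / ln (n j)"
        using n2'[of j] by (simp add: D_def)
      also have "\<dots> = 8 / ln (n j) + 6 / L j"
        using L[of j] by (simp add: L2 add_divide_distrib)
      finally have "\<bar>(?S - 2 * D j) / D j\<bar> \<le> 8 / ln (n j) + 6 / L j"
        using D[of j] by (simp add: abs_divide)
      then show "norm (?S / D j - 2) \<le> 8 / ln (n j) + 6 / L j"
        using D[of j] by (simp add: diff_divide_distrib)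
    qed
  qed (use small in simp)
  define SP where "SP j = (\<Sum>i<n j. 1 / \<bar>offP i\<bar>)" for j
  define SQ where "SQ j = (\<Sum>i<n j. 1 / \<bar>offQ i\<bar>)" for j
  have SP: "(\<lambda>j. SP j / D j) \<longlonglongrightarrow> 2"
    unfolding SP_def offP_def by (rule sumlim) (use sepP in \<open>simp add: L_def offP_def\<close>)
  have SQ: "(\<lambda>j. SQ j / D j) \<longlonglongrightarrow> 2"
    unfolding SQ_def offQ_def by (rule sumlim) (use sepQ in \<open>simp add: L_def offQ_def\<close>)
  define T where "T j = integral {0..real (n j)} (\<lambda>s. f (X + line_offset \<alpha> s 0) / h (X + line_offset \<alpha> s 0))" for j
  define G where "G j = f P * crossing_const P * SP j + f Q * crossing_const Q * SQ j" for j
  have nz: "\<forall>i<n j. offP i \<noteq> 0 \<and> offQ i \<noteq> 0" for j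
  proof (intro allI impI)
    fix i assume i: "i < n j"
    have "0 < 1 / (n j * sqrt (ln (n j)))" using n2'[of j] lnpos[of j] by (intro divide_pos_pos mult_pos_pos) auto
    then show "offP i \<noteq> 0 \<and> offQ i \<noteq> 0" using sepP[OF i] sepQ[OF i] by auto
  qed
  have err: "(\<lambda>j. (T j - G j) / D j) \<longlonglongrightarrow> 0"
  proof (rule tendstoI)
    fix \<epsilon> :: real assume "\<epsilon> > 0"
    \<comment> \<open>Each of the two normalised sums tends to 2, so the error bound tends to 4
      \<epsilon>/6 < \<epsilon>.\<close>
    then have e6: "\<epsilon> / 6 > 0" by simp
    obtain M where M: "\<And>j. \<bar>T j - f P * crossing_const P * SP j - f Q * crossing_const Q * SQ j\<bar>
        \<le> \<epsilon> / 6 * (SP j + SQ j) + M * real (n j)"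
      using orbit_integral[OF f fper e6] nz unfolding T_def SP_def SQ_def by blast
    have "(\<lambda>j. \<epsilon> / 6 * (SP j / D j + SQ j / D j) + M / ln (real (n j))) \<longlonglongrightarrow> \<epsilon> / 6 * (2 + 2) + 0"
      by (intro tendsto_intros SP SQ real_tendsto_divide_at_top[OF tendsto_const] limln)
    moreover have "\<epsilon> / 6 * (2 + 2) + 0 < \<epsilon>" using \<open>\<epsilon> > 0\<close> by simp
    ultimately have "\<forall>\<^sub>F j in sequentially. \<epsilon> / 6 * (SP j / D j + SQ j / D j) + M / ln (real (n j)) < \<epsilon>"
      by (rule order_tendstoD)
    then show "\<forall>\<^sub>F j in sequentially. dist ((T j - G j) / D j) 0 < \<epsilon>"
    proof eventually_elim
      case (elim j)
      have "\<bar>T j - G j\<bar> / D j \<le> (\<epsilon> / 6 * (SP j + SQ j) + M * real (n j)) / D j"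
        using M[of j] D[of j] unfolding G_def by (intro divide_right_mono) (simp_all add: diff_diff_eq)
      also have "\<dots> = \<epsilon> / 6 * (SP j / D j + SQ j / D j) + M / ln (real (n j))"
        using n2'[of j] by (simp add: D_def add_divide_distrib distrib_left)
      finally show ?case using elim D[of j] by (simp add: abs_divide)
    qed
  qed
  have "(\<lambda>j. (T j - G j) / D j + (f P * crossing_const P * (SP j / D j) + f Q * crossing_const Q * (SQ j / D j)))
      \<longlonglongrightarrow> 0 + (f P * crossing_const P * 2 + f Q * crossing_const Q * 2)"
    by (intro tendsto_intros err SP SQ)
  moreover have "(T j - G j) / D j + (f P * crossing_const P * (SP j / D j) + f Q * crossing_const Q * (SQ j / D j)) = T j / D j" for j
    by (simp add: G_def diff_divide_distrib add_divide_distrib)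
  ultimately show ?thesis by (simp add: T_def D_def algebra_simps)
qed

end

end

section \<open>Time change\<close>

text \<open>The orbit stays on a straight line and its position \<open>l\<close> has derivative
  \<open>h\<close>, so dt = ds / h. One \<open>t\<close> serves all \<open>f\<close>; taking f = 1
  then expresses \<open>t\<close> itself.\<close>

lemma time_change:
  fixes h :: "real^2 \<Rightarrow> real" and \<gamma> :: "real \<Rightarrow> real^2" and v X :: "real^2"
  assumes \<gamma>: "\<And>t. (\<gamma> has_vector_derivative h (\<gamma> t) *\<^sub>R v) (at t)" and \<gamma>0: "\<gamma> 0 = X"
    and v: "v $ 1 = 1" and h: "continuous_on UNIV h" and nonneg: "\<And>x. 0 \<le> h x"
    and nz: "\<And>s. 0 \<le> s \<Longrightarrow> h (X + s *\<^sub>R v) \<noteq> 0" and L: "L \<ge> 0"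
  shows "\<exists>t\<ge>0. \<forall>f :: real^2 \<Rightarrow> real. continuous_on UNIV f \<longrightarrow>
    integral {0..t} (\<lambda>s. f (\<gamma> s)) = integral {0..L} (\<lambda>s. f (X + s *\<^sub>R v) / h (X + s *\<^sub>R v))"
proof -
  define l where "l t = \<gamma> t $ 1 - X $ 1" for t
  have l': "(l has_vector_derivative h (\<gamma> t)) (at t)" for t
  proof -
    have "((\<lambda>t. \<gamma> t $ 1) has_vector_derivative (h (\<gamma> t) *\<^sub>R v) $ 1) (at t)"
      by (rule bounded_linear.has_vector_derivative[OF bounded_linear_vec_nth \<gamma>])
    then show ?thesis unfolding l_def using v by (auto intro!: derivative_eq_intros)
  qed
  then have l'real: "(l has_real_derivative h (\<gamma> t)) (at t)" for t
    by (simp add: has_real_derivative_iff_has_vector_derivative)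
  \<comment> \<open>Because \<open>v $ 1 = 1\<close>, the first coordinate measures position along
    \<open>v\<close>; subtracting that motion leaves a constant.\<close>
  have "((\<lambda>t. \<gamma> t - X - l t *\<^sub>R v) has_vector_derivative 0) (at t)" for t
  proof -
    have "((\<lambda>t. \<gamma> t - X - l t *\<^sub>R v) has_vector_derivative h (\<gamma> t) *\<^sub>R v - 0 - h (\<gamma> t) *\<^sub>R v) (at t)"
      by (intro has_vector_derivative_diff has_vector_derivative_const \<gamma>
          bounded_linear.has_vector_derivative[OF bounded_linear_scaleR_left] l')
    then show ?thesis by simp
  qed
  then obtain c where c: "\<And>t. \<gamma> t - X - l t *\<^sub>R v = c"
    using has_derivative_zero_constant[of UNIV "\<lambda>t. \<gamma> t - X - l t *\<^sub>R v"]
    by (auto simp: has_vector_derivative_def)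
  have "c = 0" using c[of 0] by (simp add: \<gamma>0 l_def)
  then have \<gamma>_eq: "\<gamma> t = X + l t *\<^sub>R v" for t using c[of t] by (simp add: algebra_simps)
  have l0: "l 0 = 0" by (simp add: l_def \<gamma>0)
  have mono: "l s \<le> l t" if "s \<le> t" for s t
    using that nonneg l'real by (intro DERIV_nonneg_imp_nondecreasing[of s t l]) auto
  have quot_cont: "continuous_on {0..M} (\<lambda>s. f (X + s *\<^sub>R v) / h (X + s *\<^sub>R v))"
    if "continuous_on UNIV f" for f :: "real^2 \<Rightarrow> real" and M
    using nz by (intro continuous_intros continuous_on_compose2[OF that] continuous_on_compose2[OF h]) auto
  have subst: "integral {0..t} (\<lambda>s. f (\<gamma> s)) = integral {0..l t} (\<lambda>s. f (X + s *\<^sub>R v) / h (X + s *\<^sub>R v))"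
    if f: "continuous_on UNIV f" and t: "t \<ge> 0" for f :: "real^2 \<Rightarrow> real" and t
  proof -
    let ?F = "\<lambda>s. f (X + s *\<^sub>R v) / h (X + s *\<^sub>R v)"
    have "((\<lambda>s. h (\<gamma> s) *\<^sub>R ?F (l s)) has_integral integral {l 0..l t} ?F) {0..t}"
    proof (rule has_integral_substitution)
      show "l ` {0..t} \<subseteq> {0..l t}"
      proof
        fix y assume "y \<in> l ` {0..t}"
        then obtain s where "y = l s" "0 \<le> s" "s \<le> t" by auto
        then show "y \<in> {0..l t}" using mono[of 0 s] mono[of s t] l0 by simp
      qed
      show "l 0 \<le> l t" using t by (rule mono)
      show "continuous_on {0..l t} ?F" using f by (rule quot_cont)
      show "(l has_real_derivative h (\<gamma> s)) (at s within {0..t})" for s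
        by (rule has_field_derivative_at_within[OF l'real])
    qed (rule t)
    moreover have "h (\<gamma> s) *\<^sub>R ?F (l s) = f (\<gamma> s)" if "s \<in> {0..t}" for s
      using nz[of "l s"] mono[of 0 s] that l0 by (simp add: \<gamma>_eq)
    ultimately have "((\<lambda>s. f (\<gamma> s)) has_integral integral {l 0..l t} ?F) {0..t}"
      by (subst (asm) has_integral_cong) auto
    then show ?thesis using l0 by (simp add: integral_unique)
  qed
  \<comment> \<open>The orbit cannot stall before \<open>L\<close>: \<open>h\<close> has no zero on
    the ray, so the travel time \<open>I\<close> is finite, and an orbit still short of
    \<open>L\<close> at time I + 1 would have used at most \<open>I\<close>.\<close>
  have "\<exists>t\<ge>0. L \<le> l t"
  proof (rule ccontr)
    assume neg: "\<not> (\<exists>t\<ge>0. L \<le> l t)"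
    define I where "I = integral {0..L} (\<lambda>s. 1 / h (X + s *\<^sub>R v))"
    have cI: "continuous_on {0..M} (\<lambda>s. 1 / h (X + s *\<^sub>R v))" for M
      by (rule quot_cont) simp
    have "0 \<le> I"
      unfolding I_def using nonneg by (intro integral_nonneg integrable_continuous_interval cI) auto
    then have "0 \<le> I + 1" by simp
    then have "\<not> L \<le> l (I + 1)" using neg by blast
    then have l: "l (I + 1) < L" by simp
    have "I + 1 = integral {0..I + 1} (\<lambda>s. 1)" using \<open>0 \<le> I\<close> by simp
    also have "\<dots> = integral {0..l (I + 1)} (\<lambda>s. 1 / h (X + s *\<^sub>R v))"
      using subst[of "\<lambda>_. 1" "I + 1"] \<open>0 \<le> I\<close> by simp
    also have "\<dots> \<le> integral {0..L} (\<lambda>s. 1 / h (X + s *\<^sub>R v))"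
      using less_imp_le[OF l] nonneg by (intro integral_subset_le integrable_continuous_interval cI) auto
    finally show False by (simp add: I_def)
  qed
  then obtain t1 where t1: "t1 \<ge> 0" "L \<le> l t1" by blast
  have "\<exists>t\<ge>0. t \<le> t1 \<and> l t = L"
    using t1 L l0 l'real by (intro IVT) (auto intro: DERIV_isCont)
  then show ?thesis using subst by blast
qed

section \<open>Well separated starting points\<close>

text \<open>Makes Tonelli available in the plane; agreement on boxes determines Lebesgue
  measure.\<close>

lemma lborel_vec2_eq_distr:
  "(lborel :: (real^2) measure) = distr (lborel \<Otimes>\<^sub>M lborel) borel (\<lambda>(x, y). vector [x, y])"
proof (rule lborel_eqI)
  have meas: "(\<lambda>(x, y). vector [x, y] :: real^2) \<in> lborel \<Otimes>\<^sub>M lborel \<rightarrow>\<^sub>M borel"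
  proof -
    have "(\<lambda>(x, y). vector [x, y] :: real^2) = (\<lambda>z. fst z *\<^sub>R axis 1 1 + snd z *\<^sub>R axis 2 1)"
      by (auto simp: vec_eq_iff forall_2 axis_def)
    then show ?thesis by simp
  qed
  have B: "(Basis :: (real^2) set) = {axis 1 1, axis 2 1}" by (auto simp: Basis_vec_def UNIV_2)
  have ne: "(axis 1 1 :: real^2) \<noteq> axis 2 1" by (simp add: axis_eq_axis)
  fix l u :: "real^2" assume le: "\<And>b. b \<in> Basis \<Longrightarrow> l \<bullet> b \<le> u \<bullet> b"
  have le': "l $ 1 \<le> u $ 1" "l $ 2 \<le> u $ 2"
    using le[of "axis 1 1"] le[of "axis 2 1"] by (simp_all add: B inner_axis)
  have pre: "(\<lambda>(x, y). vector [x, y]) -` box l u \<inter> space (lborel \<Otimes>\<^sub>M lborel) = {l$1<..<u$1} \<times> {l$2<..<u$2}"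
    by (auto simp: mem_box B inner_axis space_pair_measure)
  have "emeasure (distr (lborel \<Otimes>\<^sub>M lborel) borel (\<lambda>(x, y). vector [x, y])) (box l u) =
      emeasure (lborel \<Otimes>\<^sub>M lborel) ({l$1<..<u$1} \<times> {l$2<..<u$2})"
    using meas by (simp add: emeasure_distr pre)
  also have "\<dots> = ennreal (u$1 - l$1) * ennreal (u$2 - l$2)"
    using le' by (subst lborel.emeasure_pair_measure_Times) auto
  also have "\<dots> = ennreal (\<Prod>b\<in>Basis. (u - l) \<bullet> b)"
    using le' by (simp add: B ne inner_axis ennreal_mult)
  finally show "emeasure (distr (lborel \<Otimes>\<^sub>M lborel) borel (\<lambda>(x, y). vector [x, y])) (box l u) =
    ennreal (\<Prod>b\<in>Basis. (u - l) \<bullet> b)" .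
qed simp

text \<open>Tonelli: if all slices off the null set \<open>C\<close> vanished, so would
  \<open>B\<close>. In the application \<open>C\<close> holds the abscissas from which a stopping
  point would be level with a segment endpoint.\<close>

lemma positive_slice:
  fixes B :: "(real^2) set"
  assumes B: "B \<in> sets borel" and pos: "emeasure lborel B > 0" and C: "countable C"
  shows "\<exists>x. x \<notin> C \<and> {y. vector [x, y] \<in> B} \<in> sets borel \<and> emeasure lborel {y. vector [x, y] \<in> B} > 0"
proof (rule ccontr)
  assume neg: "\<not> ?thesis"
  have meas: "(\<lambda>(x, y). vector [x, y] :: real^2) \<in> borel \<Otimes>\<^sub>M borel \<rightarrow>\<^sub>M borel"
  proof -
    have "(\<lambda>(x, y). vector [x, y] :: real^2) = (\<lambda>z. fst z *\<^sub>R axis 1 1 + snd z *\<^sub>R axis 2 1)"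
      by (auto simp: vec_eq_iff forall_2 axis_def)
    then show ?thesis by simp
  qed
  define A where "A = (\<lambda>(x, y). vector [x, y]) -` B \<inter> space (borel \<Otimes>\<^sub>M borel)"
  have A: "A \<in> sets (borel \<Otimes>\<^sub>M borel)"
    unfolding A_def using meas B by (rule measurable_sets)
  then have A': "A \<in> sets (lborel \<Otimes>\<^sub>M lborel)"
    by (simp cong: sets_pair_measure_cong)
  have slice: "Pair x -` A = {y. vector [x, y] \<in> B}" for x
    by (auto simp: A_def space_pair_measure)
  have sl_meas: "{y. vector [x, y] \<in> B} \<in> sets borel" for x
    using sets_Pair1[OF A, of x] unfolding slice .
  have "emeasure lborel B = emeasure (lborel \<Otimes>\<^sub>M lborel) A"
    unfolding lborel_vec2_eq_distr
    using B meas by (subst emeasure_distr) (auto simp: A_def space_pair_measure cong: measurable_cong_sets sets_pair_measure_cong)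
  also have "\<dots> = (\<integral>\<^sup>+x. emeasure lborel (Pair x -` A) \<partial>lborel)"
    by (rule lborel.emeasure_pair_measure_alt[OF A'])
  also have "\<dots> = (\<integral>\<^sup>+(x::real). 0 \<partial>lborel)"
  proof (rule nn_integral_cong_AE)
    have "AE x in lborel. x \<notin> C"
      using countable_imp_null_set_lborel[OF C] by (rule AE_not_in)
    then show "AE x in lborel. emeasure lborel (Pair x -` A) = 0"
      by eventually_elim (use neg sl_meas in \<open>auto simp: slice zero_less_iff_neq_zero\<close>)
  qed
  finally show False using pos by simp
qed

text \<open>Three integers suffice because only \<open>y\<close> in \<open>[0, 1)\<close> with \<open>y + c\<close> close to an integer matter.\<close>

definition near_integers :: "real \<Rightarrow> real \<Rightarrow> real set" where
  "near_integers c \<epsilon> = (\<Union>m\<in>{0..2}. {of_int (\<lfloor>c\<rfloor> + m) - c - \<epsilon><..<of_int (\<lfloor>c\<rfloor> + m) - c + \<epsilon>})"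

lemma near_integers_measure:
  assumes "\<epsilon> \<ge> 0"
  shows "near_integers c \<epsilon> \<in> sets lborel" and "emeasure lborel (near_integers c \<epsilon>) \<le> ennreal (6 * \<epsilon>)"
proof -
  show "near_integers c \<epsilon> \<in> sets lborel" unfolding near_integers_def by simp
  have "emeasure lborel (near_integers c \<epsilon>) \<le>
      (\<Sum>m\<in>{0..2::int}. emeasure lborel {of_int (\<lfloor>c\<rfloor> + m) - c - \<epsilon><..<of_int (\<lfloor>c\<rfloor> + m) - c + \<epsilon>})"
    unfolding near_integers_def by (intro emeasure_subadditive_finite) auto
  also have "\<dots> = (\<Sum>m\<in>{0..2::int}. ennreal (2 * \<epsilon>))"
    using assms by (intro sum.cong) auto
  also have "\<dots> = ennreal (\<Sum>m\<in>{0..2::int}. 2 * \<epsilon>)"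
    using assms by (intro sum_ennreal) auto
  also have "\<dots> = ennreal (6 * \<epsilon>)" by simp
  finally show "emeasure lborel (near_integers c \<epsilon>) \<le> ennreal (6 * \<epsilon>)" .
qed

lemma near_integersI:
  assumes "\<bar>centered (y + c)\<bar> < \<epsilon>" "\<epsilon> \<le> 1" "0 \<le> y" "y < 1"
  shows "y \<in> near_integers c \<epsilon>"
proof -
  define m where "m = round (y + c)"
  have m: "\<bar>y + c - of_int m\<bar> < \<epsilon>" using assms(1) by (simp add: centered_def m_def)
  have "m \<ge> \<lfloor>c\<rfloor>"
  proof -
    have "of_int m > c - 1" using m assms by linarith
    then show ?thesis by linarith
  qed
  moreover have "m \<le> \<lfloor>c\<rfloor> + 2"
  proof -
    have "of_int m < c + 2" using m assms by linarith
    then show ?thesis by linarith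
  qed
  ultimately have "m - \<lfloor>c\<rfloor> \<in> {0..2}" by simp
  moreover have "y \<in> {of_int (\<lfloor>c\<rfloor> + (m - \<lfloor>c\<rfloor>)) - c - \<epsilon><..<of_int (\<lfloor>c\<rfloor> + (m - \<lfloor>c\<rfloor>)) - c + \<epsilon>}"
    using m by (simp add: abs_less_iff)
  ultimately show ?thesis unfolding near_integers_def by blast
qed

text \<open>Union bound over 2 N sets of measure at most 6/(N \<psi>). \<open>N\<close> cancels, so
  the bound tends to 0 whenever \<psi> grows.\<close>

lemma badly_separated_measure:
  fixes N :: nat and \<psi> \<theta> \<theta>' \<alpha> :: real
  assumes "N > 0" "\<psi> > 0"
  defines "Bad \<equiv> \<Union>i<N. near_integers (\<theta> + real i * \<alpha>) (1 / (N * \<psi>)) \<union> near_integers (\<theta>' + real i * \<alpha>) (1 / (N * \<psi>))"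
  shows "Bad \<in> sets lborel" and "emeasure lborel Bad \<le> ennreal (12 / \<psi>)"
proof -
  have e: "1 / (N * \<psi>) \<ge> 0" using assms by simp
  show "Bad \<in> sets lborel" unfolding Bad_def using near_integers_measure(1)[OF e] by auto
  have "emeasure lborel Bad \<le> (\<Sum>i<N. emeasure lborel
      (near_integers (\<theta> + real i * \<alpha>) (1 / (N * \<psi>)) \<union> near_integers (\<theta>' + real i * \<alpha>) (1 / (N * \<psi>))))"
    unfolding Bad_def using near_integers_measure(1)[OF e] by (intro emeasure_subadditive_finite) auto
  also have "\<dots> \<le> (\<Sum>i<N. ennreal (12 * (1 / (N * \<psi>))))"
  proof (rule sum_mono)
    fix i
    have "emeasure lborel (near_integers (\<theta> + real i * \<alpha>) (1 / (N * \<psi>)) \<union> near_integers (\<theta>' + real i * \<alpha>) (1 / (N * \<psi>)))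
      \<le> ennreal (6 * (1 / (N * \<psi>))) + ennreal (6 * (1 / (N * \<psi>)))"
      by (intro order_trans[OF emeasure_subadditive] add_mono near_integers_measure e)
    also have "\<dots> = ennreal (12 * (1 / (N * \<psi>)))"
      using e by (subst ennreal_plus[symmetric]) (auto simp: mult.commute simp del: ennreal_plus)
    finally show "emeasure lborel (near_integers (\<theta> + real i * \<alpha>) (1 / (N * \<psi>)) \<union> near_integers (\<theta>' + real i * \<alpha>) (1 / (N * \<psi>)))
      \<le> ennreal (12 * (1 / (N * \<psi>)))" .
  qed
  also have "\<dots> = ennreal (\<Sum>i<N. 12 * (1 / (N * \<psi>)))" using e by (intro sum_ennreal) auto
  also have "(\<Sum>i<N. 12 * (1 / (N * \<psi>))) = 12 / \<psi>" using assms by simp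
  finally show "emeasure lborel Bad \<le> ennreal (12 / \<psi>)" .
qed

text \<open>The heights that are bad from some index on form a countable union of intersections of
  sets with measures tending to 0, hence a null set. So some \<open>y\<close> in \<open>S\<close> is
  good infinitely often. The denominators are chosen from \<alpha> alone, the subsequence from
  \<open>y\<close>.\<close>

lemma well_separated_times:
  fixes S :: "real set"
  assumes \<alpha>: "\<alpha> \<notin> \<rat>" and S: "S \<in> sets borel" "S \<subseteq> {0..<1}" "emeasure lborel S > 0"
  shows "\<exists>y\<in>S. \<exists>(n :: nat \<Rightarrow> nat) k. filterlim n at_top sequentially \<and>
    (\<forall>j. n j \<ge> 2 \<and> coprime (k j) (int (n j)) \<and> \<bar>\<alpha> - of_int (k j) / real (n j)\<bar> < 1 / (real (n j))\<^sup>2 \<and>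
      (\<forall>i<n j. 1 / (n j * sqrt (ln (n j))) \<le> \<bar>centered (y + (\<theta> + real i * \<alpha>))\<bar> \<and>
               1 / (n j * sqrt (ln (n j))) \<le> \<bar>centered (y + (\<theta>' + real i * \<alpha>))\<bar>))"
proof -
  \<comment> \<open>The 3 forces N \<ge> 4 > e, hence ln N \<ge> 1 and cutoffs of at most 1, as
    \<open>near_integersI\<close> requires.\<close>
  have "\<forall>j. \<exists>(N :: nat) a. N > j + 3 \<and> coprime a (int N) \<and> \<bar>\<alpha> - of_int a / real N\<bar> < 1 / (real N)\<^sup>2"
    using rational_approximations_unbounded[OF \<alpha>] by blast
  then obtain N :: "nat \<Rightarrow> nat" and a where N: "\<And>j. N j > j + 3" and cop: "\<And>j. coprime (a j) (int (N j))"
    and appr: "\<And>j. \<bar>\<alpha> - of_int (a j) / real (N j)\<bar> < 1 / (real (N j))\<^sup>2"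
    by metis
  define \<psi> where "\<psi> j = sqrt (ln (real (N j)))" for j
  have \<psi>1: "\<psi> j \<ge> 1" for j
  proof -
    have "exp 1 \<le> real (N j)" using exp_le N[of j] by linarith
    then have "1 \<le> ln (real (N j))" using N[of j] by (subst ln_ge_iff) auto
    then show ?thesis by (simp add: \<psi>_def)
  qed
  have Nlim: "filterlim N at_top sequentially"
  proof (rule filterlim_at_top_mono[OF filterlim_ident], rule always_eventually, rule allI)
    show "j \<le> N j" for j using N[of j] by linarith
  qed
  have \<psi>lim: "filterlim \<psi> at_top sequentially"
    unfolding \<psi>_def
    by (intro filterlim_compose[OF sqrt_at_top] filterlim_compose[OF ln_at_top]
        filterlim_compose[OF filterlim_real_sequentially] Nlim)
  define Bad where "Bad j = (\<Union>i<N j. near_integers (\<theta> + real i * \<alpha>) (1 / (N j * \<psi> j)) \<union>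
      near_integers (\<theta>' + real i * \<alpha>) (1 / (N j * \<psi> j)))" for j
  have pos: "N j > 0" "\<psi> j > 0" for j
  proof -
    show "N j > 0" using N[of j] by linarith
    show "\<psi> j > 0" using \<psi>1[of j] by linarith
  qed
  have Bad: "Bad j \<in> sets lborel" "emeasure lborel (Bad j) \<le> ennreal (12 / \<psi> j)" for j
    unfolding Bad_def by (rule badly_separated_measure[OF pos])+
  have lim0: "(\<lambda>j. ennreal (12 / \<psi> j)) \<longlonglongrightarrow> ennreal 0"
    by (intro tendsto_ennrealI real_tendsto_divide_at_top[OF tendsto_const] \<psi>lim)
  have null: "(\<Inter>j\<in>{k..}. Bad j) \<in> null_sets lborel" for k
  proof (rule null_setsI)
    show m: "(\<Inter>j\<in>{k..}. Bad j) \<in> sets lborel" using Bad(1) by (intro sets.countable_INT) auto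
    have "emeasure lborel (\<Inter>j\<in>{k..}. Bad j) \<le> ennreal (12 / \<psi> j)" if "j \<ge> k" for j
      using that by (intro order_trans[OF emeasure_mono Bad(2)] Bad(1)) auto
    then have "emeasure lborel (\<Inter>j\<in>{k..}. Bad j) \<le> ennreal 0"
      by (intro LIMSEQ_le_const[OF lim0]) blast
    then show "emeasure lborel (\<Inter>j\<in>{k..}. Bad j) = 0" by simp
  qed
  have U: "(\<Union>k. \<Inter>j\<in>{k..}. Bad j) \<in> null_sets lborel" using null by (intro null_sets_UN) auto
  have "\<not> S \<subseteq> (\<Union>k. \<Inter>j\<in>{k..}. Bad j)"
  proof
    assume "S \<subseteq> (\<Union>k. \<Inter>j\<in>{k..}. Bad j)"
    then have "emeasure lborel S \<le> emeasure lborel (\<Union>k. \<Inter>j\<in>{k..}. Bad j)"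
      using U by (intro emeasure_mono) auto
    also have "\<dots> = 0" using U by (rule null_setsD1)
    finally show False using S(3) by simp
  qed
  then obtain y where y: "y \<in> S" and "y \<notin> (\<Union>k. \<Inter>j\<in>{k..}. Bad j)" by blast
  then have infin: "\<exists>j\<ge>k. y \<notin> Bad j" for k by auto
  have "infinite {j. y \<notin> Bad j}" unfolding infinite_nat_iff_unbounded_le using infin by auto
  then obtain r :: "nat \<Rightarrow> nat" where r: "strict_mono r" "\<And>j. y \<notin> Bad (r j)"
    using infinite_enumerate by blast
  have y01: "0 \<le> y" "y < 1" using y S(2) by auto
  have sep: "1 / (N (r j) * \<psi> (r j)) \<le> \<bar>centered (y + (\<theta> + real i * \<alpha>))\<bar> \<and>
      1 / (N (r j) * \<psi> (r j)) \<le> \<bar>centered (y + (\<theta>' + real i * \<alpha>))\<bar>" if i: "i < N (r j)" for i j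
  proof -
    have "1 * 1 \<le> real (N (r j)) * \<psi> (r j)" using pos[of "r j"] \<psi>1[of "r j"] by (intro mult_mono) auto
    then have e: "1 / (N (r j) * \<psi> (r j)) \<le> 1" by simp
    have "y \<notin> near_integers (\<theta> + real i * \<alpha>) (1 / (N (r j) * \<psi> (r j)))"
      "y \<notin> near_integers (\<theta>' + real i * \<alpha>) (1 / (N (r j) * \<psi> (r j)))"
      using r(2)[of j] i unfolding Bad_def by blast+
    then show ?thesis using near_integersI[OF _ e y01] by (meson not_le)
  qed
  show ?thesis
  proof (intro bexI[OF _ y] exI[of _ "N \<circ> r"] exI[of _ "a \<circ> r"] conjI allI impI)
    show "filterlim (N \<circ> r) at_top sequentially"
      unfolding o_def by (rule filterlim_compose[OF Nlim filterlim_subseq[OF r(1)]])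
    fix j
    show "2 \<le> (N \<circ> r) j" using N[of "r j"] by simp
    show "coprime ((a \<circ> r) j) (int ((N \<circ> r) j))" using cop by simp
    show "\<bar>\<alpha> - of_int ((a \<circ> r) j) / real ((N \<circ> r) j)\<bar> < 1 / (real ((N \<circ> r) j))\<^sup>2" using appr[of "r j"] by simp
    fix i assume i: "i < (N \<circ> r) j"
    show "1 / (real ((N \<circ> r) j) * sqrt (ln (real ((N \<circ> r) j)))) \<le> \<bar>centered (y + (\<theta> + real i * \<alpha>))\<bar>"
      "1 / (real ((N \<circ> r) j) * sqrt (ln (real ((N \<circ> r) j)))) \<le> \<bar>centered (y + (\<theta>' + real i * \<alpha>))\<bar>"
      using sep[of i j] i by (auto simp: \<psi>_def)
  qed
qed

section \<open>Empirical measures\<close>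

text \<open>\<open>is_empirical\<close> only prescribes integrals; the witness is the image of the
  uniform distribution on [0, t] under the orbit map.\<close>

lemma empirical_measure_exists:
  fixes F :: "real \<Rightarrow> torus \<Rightarrow> torus"
  assumes cont: "continuous_on UNIV (\<lambda>s. F s x)" and t: "t > 0"
  shows "\<exists>M. is_empirical F t x M"
proof -
  define U where "U = uniform_measure lborel {0..t}"
  have em: "emeasure lborel {0..t} = ennreal t" using t by simp
  interpret U: prob_space U
    unfolding U_def using t by (intro prob_space_uniform_measure) auto
  have m: "(\<lambda>s. F s x) \<in> U \<rightarrow>\<^sub>M borel"
    unfolding U_def using borel_measurable_continuous_onI[OF cont] by simp
  define M where "M = distr U borel (\<lambda>s. F s x)"
  have "prob_space M" unfolding M_def by (rule U.prob_space_distr[OF m])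
  moreover have "(\<integral>y. f y \<partial>M) = 1 / t * integral {0..t} (\<lambda>s. f (F s x))"
    if f: "continuous_on UNIV f" for f :: "torus \<Rightarrow> real"
  proof -
    have fm: "f \<in> borel_measurable borel" using f by (rule borel_measurable_continuous_onI)
    have c: "continuous_on UNIV (\<lambda>s. f (F s x))" using continuous_on_compose2[OF f cont] by simp
    then have cm [measurable]: "(\<lambda>s. f (F s x)) \<in> borel_measurable borel" by (rule borel_measurable_continuous_onI)
    have "(\<integral>y. f y \<partial>M) = (\<integral>s. f (F s x) \<partial>U)"
      unfolding M_def by (rule integral_distr[OF m fm])
    also have "\<dots> = (\<integral>s. indicator {0..t} s / t * f (F s x) \<partial>lborel)"
    proof -
      have "U = density lborel (\<lambda>s. ennreal (indicator {0..t} s / t))"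
        unfolding U_def uniform_measure_def em
        using divide_ennreal[of 1 t] t
        by (intro density_cong AE_I2) (simp_all split: split_indicator)
      then show ?thesis using t by (simp add: integral_density)
    qed
    also have "\<dots> = (1 / t) * (\<integral>s. indicator {0..t} s *\<^sub>R f (F s x) \<partial>lborel)"
      by (subst integral_mult_right_zero[symmetric]) simp
    also have "(\<integral>s. indicator {0..t} s *\<^sub>R f (F s x) \<partial>lborel) = integral {0..t} (\<lambda>s. f (F s x))"
      using set_borel_integral_eq_integral(2)[OF borel_integrable_atLeastAtMost'[OF continuous_on_subset[OF c]], of 0 t]
      by (simp add: set_lebesgue_integral_def)
    finally show ?thesis .
  qed
  ultimately show ?thesis unfolding is_empirical_def borel_probs_def M_def by (intro exI[of _ M]) (auto simp: M_def)
qed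

text \<open>As the image of a biased coin toss, the measure inherits total mass 1 and its
  integration formula from \<open>bernoulli_pmf\<close>.\<close>

lemma two_diracs_eq_distr:
  assumes "0 \<le> a" "0 \<le> b" "a + b = 1"
  shows "two_diracs a p b q = distr (measure_pmf (bernoulli_pmf a)) borel (\<lambda>c. if c then p else q)"
proof (rule measure_eqI)
  fix A assume "A \<in> sets (two_diracs a p b q)"
  then have A: "A \<in> sets borel" by (simp add: sets_two_diracs)
  have b: "b = 1 - a" and a1: "a \<le> 1" using assms by auto
  have "emeasure (distr (measure_pmf (bernoulli_pmf a)) borel (\<lambda>c. if c then p else q)) A =
      emeasure (measure_pmf (bernoulli_pmf a)) {c. (if c then p else q) \<in> A}"
    using A by (simp add: emeasure_distr vimage_def)
  also have "\<dots> = (\<integral>\<^sup>+c. indicator {c. (if c then p else q) \<in> A} c \<partial>measure_pmf (bernoulli_pmf a))"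
    by simp
  also have "\<dots> = ennreal a * indicator A p + ennreal b * indicator A q"
    using assms a1 unfolding b by (subst nn_integral_bernoulli_pmf) (auto split: split_indicator simp: mult.commute)
  finally show "emeasure (two_diracs a p b q) A =
      emeasure (distr (measure_pmf (bernoulli_pmf a)) borel (\<lambda>c. if c then p else q)) A"
    using A by (simp add: emeasure_two_diracs)
qed (simp add: sets_two_diracs)

lemma two_diracs_in_borel_probs:
  assumes "0 \<le> a" "0 \<le> b" "a + b = 1"
  shows "two_diracs a p b q \<in> borel_probs"
  unfolding borel_probs_def two_diracs_eq_distr[OF assms]
  by (auto intro!: measure_pmf.prob_space_distr)

lemma integral_two_diracs:
  fixes f :: "torus \<Rightarrow> real"
  assumes "0 \<le> a" "0 \<le> b" "a + b = 1" "continuous_on UNIV f"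
  shows "(\<integral>x. f x \<partial>two_diracs a p b q) = a * f p + b * f q"
proof -
  have "(\<integral>x. f x \<partial>two_diracs a p b q) = (\<integral>c. f (if c then p else q) \<partial>measure_pmf (bernoulli_pmf a))"
    unfolding two_diracs_eq_distr[OF assms(1-3)]
    by (intro integral_distr borel_measurable_continuous_onI assms(4)) simp
  also have "\<dots> = a * f p + b * f q"
  proof -
    have b: "b = 1 - a" and "a \<le> 1" using assms(1-3) by linarith+
    then show ?thesis using assms(1) by (simp add: b mult.commute)
  qed
  finally show ?thesis .
qed

text \<open>Convergence of integrals handles the subbasic sets; induction on the generated topology
  carries this through finite intersections and arbitrary unions.\<close>

lemma weak_star_eventually_in_open:
  assumes "openin weak_star U" "N \<in> U"
    and conv: "\<And>f :: torus \<Rightarrow> real. continuous_on UNIV f \<Longrightarrow> (\<lambda>j. \<integral>x. f x \<partial>M j) \<longlonglongrightarrow> (\<integral>x. f x \<partial>N)"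
    and M: "\<And>j. M j \<in> borel_probs"
  shows "\<forall>\<^sub>F j in sequentially. M j \<in> U"
proof -
  let ?S = "{{M \<in> borel_probs. (\<integral>x. f x \<partial>M) \<in> U} | (f :: torus \<Rightarrow> real) U. continuous_on UNIV f \<and> open U}"
  have "generate_topology_on ?S U" using assms(1) unfolding weak_star_def openin_topology_generated_by_iff .
  then show ?thesis using assms(2)
  proof induction
    case Empty
    then show ?case by simp
  next
    case (Int A B)
    then show ?case by (auto intro: eventually_conj)
  next
    case (UN K)
    then obtain A where "A \<in> K" "N \<in> A" by blast
    with UN.IH have "\<forall>\<^sub>F j in sequentially. M j \<in> A" by blast
    then show ?case by eventually_elim (use \<open>A \<in> K\<close> in blast)
  next
    case (Basis A)
    then obtain f :: "torus \<Rightarrow> real" and V where A: "A = {M \<in> borel_probs. (\<integral>x. f x \<partial>M) \<in> V}"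
      "continuous_on UNIV f" "open V" by blast
    then have "(\<integral>x. f x \<partial>N) \<in> V" using Basis by simp
    with conv[OF A(2)] A(3) have "\<forall>\<^sub>F j in sequentially. (\<integral>x. f x \<partial>M j) \<in> V"
      by (rule topological_tendstoD)
    then show ?case by eventually_elim (simp add: A(1) M)
  qed
qed

text \<open>One sequence of times is enough, since its tail beyond \<open>T\<close> supplies members
  of each set whose closure is intersected.\<close>

lemma two_diracs_in_p_omega:
  fixes F :: "real \<Rightarrow> torus \<Rightarrow> torus"
  assumes ab: "0 \<le> a" "0 \<le> b" "a + b = 1"
    and cont: "continuous_on UNIV (\<lambda>s. F s x)"
    and t: "filterlim t at_top sequentially"
    and conv: "\<And>f :: torus \<Rightarrow> real. continuous_on UNIV f \<Longrightarrow>
      (\<lambda>j. 1 / t j * integral {0..t j} (\<lambda>s. f (F s x))) \<longlonglongrightarrow> a * f p + b * f q"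
  shows "two_diracs a p b q \<in> p_omega F x"
  unfolding p_omega_def
proof
  fix T :: real assume "T \<in> {0<..}"
  then have T: "T > 0" by simp
  obtain j0 where j0: "\<And>j. j \<ge> j0 \<Longrightarrow> t j \<ge> T"
    using t unfolding filterlim_at_top eventually_sequentially by blast
  define t' where "t' j = t (j + j0)" for j
  have t': "t' j \<ge> T" for j using j0 by (simp add: t'_def)
  have "\<forall>j. \<exists>M. is_empirical F (t' j) x M"
    using empirical_measure_exists[of F x, OF cont] t' T by (meson less_le_trans)
  then obtain M where M: "\<And>j. is_empirical F (t' j) x (M j)" by metis
  have conv': "(\<lambda>j. \<integral>y. f y \<partial>M j) \<longlonglongrightarrow> (\<integral>y. f y \<partial>two_diracs a p b q)"
    if f: "continuous_on UNIV f" for f :: "torus \<Rightarrow> real"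
  proof -
    have "(\<lambda>j. 1 / t' j * integral {0..t' j} (\<lambda>s. f (F s x))) \<longlonglongrightarrow> a * f p + b * f q"
      unfolding t'_def by (rule LIMSEQ_ignore_initial_segment[OF conv[OF f]])
    then show ?thesis using M f by (simp add: is_empirical_def integral_two_diracs[OF ab f])
  qed
  show "two_diracs a p b q \<in> weak_star closure_of {M. \<exists>t\<ge>T. is_empirical F t x M}"
    unfolding in_closure_of topspace_weak_star
  proof (intro conjI two_diracs_in_borel_probs ab allI impI)
    fix U assume "two_diracs a p b q \<in> U \<and> openin weak_star U"
    then have "\<forall>\<^sub>F j in sequentially. M j \<in> U"
      using M conv' by (intro weak_star_eventually_in_open) (auto simp: is_empirical_def)
    then obtain j where "M j \<in> U" unfolding eventually_sequentially by blast
    then show "\<exists>y. y \<in> {M. \<exists>t\<ge>T. is_empirical F t x M} \<and> y \<in> U" using M t' by blast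
  qed
qed

section \<open>The limit measure\<close>

lemma to_torus_eq_iff_torus_rel: "to_torus x = to_torus y \<longleftrightarrow> torus_rel x y"
  by (simp add: to_torus_eq_iff torus_rel_def)

lemma reparam_linear_flow_two_stopping_points:
  assumes "reparam_linear_flow \<alpha> \<phi> p q F"
  shows "two_stopping_points (\<phi> \<circ> to_torus) (rep_torus p) (rep_torus q)"
proof -
  have C3: "C_k (Suc 2) (\<phi> \<circ> to_torus)" and pq: "p \<noteq> q" and z: "\<phi> p = 0" "\<phi> q = 0"
    and pos: "\<And>x. x \<noteq> p \<Longrightarrow> x \<noteq> q \<Longrightarrow> \<phi> x > 0"
    and pd: "pos_definite (hessian \<phi> p)" "pos_definite (hessian \<phi> q)"
    using assms by (simp_all add: reparam_linear_flow_def numeral_3_eq_3 numeral_2_eq_2)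
  have rel: "torus_rel x (rep_torus r) \<longleftrightarrow> to_torus x = r" for x r
    by (simp add: to_torus_eq_iff_torus_rel[symmetric] to_torus_rep_torus)
  show ?thesis
  proof
    show "C_k 2 (\<phi> \<circ> to_torus)" by (rule C_k_SucD[OF C3])
    show "0 \<le> (\<phi> \<circ> to_torus) x" for x
      using pos[of "to_torus x"] z by (cases "to_torus x = p \<or> to_torus x = q") auto
    show "(\<phi> \<circ> to_torus) x = (\<phi> \<circ> to_torus) y" if "torus_rel x y" for x y
      using that by (simp add: to_torus_eq_iff_torus_rel[symmetric])
    show "((\<phi> \<circ> to_torus) x = 0) = (torus_rel x (rep_torus p) \<or> torus_rel x (rep_torus q))" for x
      using pos[of "to_torus x"] z
      by (cases "to_torus x = p"; cases "to_torus x = q") (auto simp: rel)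
    show "\<not> torus_rel (rep_torus p) (rep_torus q)"
      using pq by (simp add: rel to_torus_rep_torus)
    show "pos_definite (plane_hessian (\<phi> \<circ> to_torus) (rep_torus p))"
      "pos_definite (plane_hessian (\<phi> \<circ> to_torus) (rep_torus q))"
      using pd by (simp_all add: hessian_def plane_hessian_def)
  qed
qed

text \<open>On a vertical slice \<open>a\<close> and \<open>b\<close> are constant, so separation
  concerns the height only. Abscissas congruent to those of \<open>P\<close> or \<open>Q\<close> are
  avoided: this keeps both phases strictly between 0 and 1, and the singularities interior to the
  segments.\<close>

lemma well_separated_point:
  fixes P Q :: "real^2" and \<alpha> :: real
  assumes \<alpha>: "\<alpha> \<notin> \<rat>" and B: "B \<in> sets borel" "emeasure haar_torus B > 0"
  obtains X a b and n :: "nat \<Rightarrow> nat" and k :: "nat \<Rightarrow> int" where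
    "to_torus X \<in> B" "0 < a" "a < 1" "0 < b" "b < 1"
    "X $ 1 + a - P $ 1 \<in> \<int>" "X $ 1 + b - Q $ 1 \<in> \<int>"
    "filterlim n at_top sequentially" "\<And>j. n j \<ge> 2" "\<And>j. coprime (k j) (int (n j))"
    "\<And>j. \<bar>\<alpha> - of_int (k j) / real (n j)\<bar> < 1 / (real (n j))\<^sup>2"
    "\<And>i j. i < n j \<Longrightarrow> 1 / (n j * sqrt (ln (n j))) \<le> \<bar>centered (X $ 2 + a * \<alpha> - P $ 2 + real i * \<alpha>)\<bar>"
    "\<And>i j. i < n j \<Longrightarrow> 1 / (n j * sqrt (ln (n j))) \<le> \<bar>centered (X $ 2 + b * \<alpha> - Q $ 2 + real i * \<alpha>)\<bar>"
proof -
  define B' where "B' = to_torus -` B \<inter> {x. \<forall>i. 0 \<le> x $ i \<and> x $ i < 1}"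
  have "to_torus \<in> borel_measurable borel"
    by (rule borel_measurable_continuous_onI[OF continuous_to_torus])
  then have "to_torus -` B \<in> sets borel" using B(1) measurable_sets[of to_torus borel borel B] by simp
  then have "B' \<in> sets borel" unfolding B'_def by measurable
  moreover have "emeasure lborel B' > 0" using B by (simp add: emeasure_haar_torus B'_def)
  moreover have "countable ((\<lambda>k. P $ 1 + k) ` \<int> \<union> (\<lambda>k. Q $ 1 + k) ` \<int>)"
    using countable_int by auto
  ultimately obtain x where x: "x \<notin> (\<lambda>k. P $ 1 + k) ` \<int> \<union> (\<lambda>k. Q $ 1 + k) ` \<int>"
    and S: "{y. vector [x, y] \<in> B'} \<in> sets borel" "emeasure lborel {y. vector [x, y] \<in> B'} > 0"
    using positive_slice by blast
  define a where "a = frac (P $ 1 - x)"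
  define b where "b = frac (Q $ 1 - x)"
  have frac_pos: "frac (r - x) > 0" if "x \<notin> (\<lambda>k. r + k) ` \<int>" for r
  proof -
    have "r - x \<notin> \<int>"
    proof
      assume "r - x \<in> \<int>"
      then have "- (r - x) \<in> \<int>" by (rule Ints_minus)
      moreover have "x = r + - (r - x)" by simp
      ultimately show False using that by blast
    qed
    then show ?thesis by (simp add: less_le frac_ge_0)
  qed
  have ab: "0 < a" "a < 1" "0 < b" "b < 1"
    unfolding a_def b_def using x by (blast intro: frac_pos frac_lt_1)+
  have sub: "{y. vector [x, y] \<in> B'} \<subseteq> {0..<1}" by (auto simp: B'_def forall_2)
  obtain y n k where y: "vector [x, y] \<in> B'"
    and nk: "filterlim n at_top sequentially \<and>
    (\<forall>j. n j \<ge> 2 \<and> coprime (k j) (int (n j)) \<and> \<bar>\<alpha> - of_int (k j) / real (n j)\<bar> < 1 / (real (n j))\<^sup>2 \<and>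
      (\<forall>i<n j. 1 / (n j * sqrt (ln (n j))) \<le> \<bar>centered (y + (a * \<alpha> - P $ 2 + real i * \<alpha>))\<bar> \<and>
               1 / (n j * sqrt (ln (n j))) \<le> \<bar>centered (y + (b * \<alpha> - Q $ 2 + real i * \<alpha>))\<bar>))"
    using well_separated_times[OF \<alpha> S(1) sub S(2), of "a * \<alpha> - P $ 2" "b * \<alpha> - Q $ 2"]
    by (elim bexE exE) (rule that, simp)
  show ?thesis
  proof (rule that[of "vector [x, y]" a b n k])
    show "to_torus (vector [x, y]) \<in> B" using y by (simp add: B'_def)
    show "(vector [x, y] :: real^2) $ 1 + a - P $ 1 \<in> \<int>"
      "(vector [x, y] :: real^2) $ 1 + b - Q $ 1 \<in> \<int>"
      by (simp_all add: a_def b_def frac_def)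
    show "1 / (n j * sqrt (ln (n j))) \<le> \<bar>centered ((vector [x, y] :: real^2) $ 2 + a * \<alpha> - P $ 2 + real i * \<alpha>)\<bar>"
      "1 / (n j * sqrt (ln (n j))) \<le> \<bar>centered ((vector [x, y] :: real^2) $ 2 + b * \<alpha> - Q $ 2 + real i * \<alpha>)\<bar>"
      if "i < n j" for i j
      using nk that by (simp_all only: vector_2 add_diff_eq add.assoc[symmetric])
  qed (use ab nk in auto)
qed

theorem proposition3p7:
  fixes \<alpha> :: real and \<phi> :: "torus \<Rightarrow> real" and p q :: torus
    and F :: "real \<Rightarrow> torus \<Rightarrow> torus" and \<mu> :: "torus measure"
  defines "dp \<equiv> det (hessian \<phi> p)" and "dq \<equiv> det (hessian \<phi> q)"
  assumes "reparam_linear_flow \<alpha> \<phi> p q F"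
    and "physical_measure F \<mu>"
  shows "\<mu> = two_diracs (sqrt dq / (sqrt dp + sqrt dq)) p (sqrt dp / (sqrt dp + sqrt dq)) q"
proof -
  define h where "h = \<phi> \<circ> to_torus"
  define P where "P = rep_torus p"
  define Q where "Q = rep_torus q"
  interpret two_stopping_points h P Q
    unfolding h_def P_def Q_def by (rule reparam_linear_flow_two_stopping_points[OF assms(3)])
  have \<alpha>: "\<alpha> \<notin> \<rat>" and flow: "generates_flow (\<lambda>x. \<phi> x *\<^sub>R vector [1, \<alpha>]) F"
    using assms(3) by (auto simp: reparam_linear_flow_def)
  have pos: "emeasure haar_torus {x. p_omega F x = {\<mu>}} > 0"
    using assms(4) by (simp add: physical_measure_def)
  then have "emeasure haar_torus {x. p_omega F x = {\<mu>}} \<noteq> 0" by simp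
  \<comment> \<open>Nonmeasurable sets have \<open>emeasure\<close> 0, so positivity already gives
    measurability of the basin.\<close>
  then have "{x. p_omega F x = {\<mu>}} \<in> sets haar_torus" using emeasure_notin_sets by blast
  then have meas: "{x. p_omega F x = {\<mu>}} \<in> sets borel" by (simp add: haar_torus_def)
  obtain X a b and n :: "nat \<Rightarrow> nat" and k :: "nat \<Rightarrow> int"
    where "to_torus X \<in> {x. p_omega F x = {\<mu>}}"
    and ab: "0 < a" "a < 1" "0 < b" "b < 1"
    and int: "X $ 1 + a - P $ 1 \<in> \<int>" "X $ 1 + b - Q $ 1 \<in> \<int>"
    and n: "filterlim n at_top sequentially" and n2: "\<And>j. n j \<ge> 2" and cop: "\<And>j. coprime (k j) (int (n j))"
    and appr: "\<And>j. \<bar>\<alpha> - of_int (k j) / real (n j)\<bar> < 1 / (real (n j))\<^sup>2"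
    and sep: "\<And>i j. i < n j \<Longrightarrow> 1 / (n j * sqrt (ln (n j))) \<le> \<bar>centered (X $ 2 + a * \<alpha> - P $ 2 + real i * \<alpha>)\<bar>"
      "\<And>i j. i < n j \<Longrightarrow> 1 / (n j * sqrt (ln (n j))) \<le> \<bar>centered (X $ 2 + b * \<alpha> - Q $ 2 + real i * \<alpha>)\<bar>"
    by (rule well_separated_point[OF \<alpha> meas pos, of P Q]) (rule that)
  then have X: "p_omega F (to_torus X) = {\<mu>}" by simp
  define v :: "real^2" where "v = vector [1, \<alpha>]"
  have line: "line_offset \<alpha> s 0 = s *\<^sub>R v" for s
    by (simp add: v_def vec_eq_iff forall_2)
  define T where "T f j = integral {0..real (n j)} (\<lambda>s. f (X + s *\<^sub>R v) / h (X + s *\<^sub>R v))" for f j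
  define D where "D j = real (n j) * ln (real (n j))" for j
  have lim: "(\<lambda>j. T f j / D j) \<longlonglongrightarrow> 2 * (f P * crossing_const P + f Q * crossing_const Q)"
    if "continuous_on UNIV f" "\<And>x y. torus_rel x y \<Longrightarrow> f x = f y" for f :: "real^2 \<Rightarrow> real"
    using orbit_integral_asymptotics[OF ab int that n n2 cop appr] sep
    unfolding T_def D_def line offP_def[OF ab int] offQ_def[OF ab int] by blast
  have lnpos: "ln (real (n j)) > 0" for j using n2[of j] by (intro ln_gt_zero) linarith
  have Dpos: "D j > 0" for j using n2[of j] lnpos[of j] by (simp add: D_def)
  have Dlim: "filterlim D at_top sequentially"
    unfolding D_def
    by (intro filterlim_at_top_mult_at_top filterlim_compose[OF ln_at_top]
        filterlim_compose[OF filterlim_real_sequentially n])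
  \<comment> \<open>Every \<open>s\<close> lies below some \<open>n j\<close>, and separation at
    that index keeps all offsets up to it nonzero.\<close>
  have nz: "h (X + s *\<^sub>R v) \<noteq> 0" if "0 \<le> s" for s
  proof -
    obtain j where j: "s \<le> real (n j)"
      using filterlim_compose[OF filterlim_real_sequentially n]
      unfolding filterlim_at_top eventually_sequentially by blast
    have "0 < 1 / (n j * sqrt (ln (n j)))"
      using n2[of j] lnpos[of j] by (intro divide_pos_pos mult_pos_pos) auto
    then have "offP \<alpha> a X i \<noteq> 0" "offQ \<alpha> b X i \<noteq> 0" if "i < n j" for i
      using sep[OF that] unfolding offP_def[OF ab int] offQ_def[OF ab int] by auto
    then show ?thesis
      using orbit_h_nonzero[OF ab int, of "n j" \<alpha> s] that j n2[of j] unfolding line by auto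
  qed
  obtain \<gamma> where \<gamma>: "\<gamma> 0 = X" "\<And>t. (\<gamma> has_vector_derivative h (\<gamma> t) *\<^sub>R v) (at t)"
    "\<And>t. F t (to_torus X) = to_torus (\<gamma> t)"
    using flow unfolding generates_flow_def h_def v_def o_def by metis
  have "continuous_on UNIV \<gamma>"
    using \<gamma>(2) by (intro continuous_at_imp_continuous_on) (auto intro: has_vector_derivative_continuous)
  then have cont: "continuous_on UNIV (\<lambda>s. F s (to_torus X))"
    unfolding \<gamma>(3) using continuous_on_compose2[OF continuous_to_torus] by simp
  have v1: "v $ 1 = 1" by (simp add: v_def)
  have "\<forall>j. \<exists>t\<ge>0. \<forall>f :: real^2 \<Rightarrow> real. continuous_on UNIV f \<longrightarrow>
      integral {0..t} (\<lambda>s. f (\<gamma> s)) = T f j"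
    unfolding T_def using time_change[OF \<gamma>(2,1) v1 continuous_h nonneg nz] by simp
  then obtain t where t: "\<And>j. t j \<ge> 0"
    and tT: "\<And>j f. continuous_on UNIV f \<Longrightarrow> integral {0..t j} (\<lambda>s. f (\<gamma> s)) = T f j"
    by metis
  \<comment> \<open>The case f = 1: elapsed time is itself one of the integrals with known
    asymptotics.\<close>
  have t1: "t j = T (\<lambda>_. 1) j" for j using tT[of "\<lambda>_. 1" j] t[of j] by simp
  have d: "dp = det (plane_hessian h P)" "dq = det (plane_hessian h Q)"
    by (simp_all add: dp_def dq_def hessian_def plane_hessian_def h_def P_def Q_def)
  have dpos: "dp > 0" "dq > 0"
    unfolding d using pos_definite_2D(3)[OF pdP] pos_definite_2D(3)[OF pdQ] by auto
  have cc: "crossing_const P = 2 * pi / sqrt dp" "crossing_const Q = 2 * pi / sqrt dq"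
    unfolding d crossing_const_def by (rule refl)+
  have ccpos: "crossing_const P + crossing_const Q > 0"
    using dpos unfolding cc by (intro add_pos_pos divide_pos_pos) auto
  have lim1: "(\<lambda>j. t j / D j) \<longlonglongrightarrow> 2 * (crossing_const P + crossing_const Q)"
    using lim[of "\<lambda>_. 1"] by (simp add: t1[abs_def])
  have "filterlim (\<lambda>j. t j / D j * D j) at_top sequentially"
    using ccpos by (intro filterlim_tendsto_pos_mult_at_top[OF lim1] Dlim) simp
  moreover have "t j / D j * D j = t j" for j using Dpos[of j] by simp
  ultimately have tlim: "filterlim t at_top sequentially" by simp
  define wp where "wp = sqrt dq / (sqrt dp + sqrt dq)"
  define wq where "wq = sqrt dp / (sqrt dp + sqrt dq)"
  have s: "sqrt dp > 0" "sqrt dq > 0" using dpos by auto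
  have w: "0 \<le> wp" "0 \<le> wq" "wp + wq = 1"
  proof -
    have ne: "sqrt dp + sqrt dq \<noteq> 0" using s by linarith
    show "0 \<le> wp" "0 \<le> wq" unfolding wp_def wq_def using s by (auto intro: divide_nonneg_nonneg)
    have "wp + wq = (sqrt dp + sqrt dq) / (sqrt dp + sqrt dq)"
      by (simp only: wp_def wq_def add_divide_distrib add.commute)
    also have "\<dots> = 1" by (rule divide_self[OF ne])
    finally show "wp + wq = 1" .
  qed
  \<comment> \<open>Clearing the denominators sqrt dp and sqrt dq of the two crossing constants
    swaps the determinants.\<close>
  have weights: "(x * crossing_const P + y * crossing_const Q) / (crossing_const P + crossing_const Q)
      = wp * x + wq * y" for x y
  proof -
    have e: "x * crossing_const P + y * crossing_const Q = 2 * pi / (sqrt dp * sqrt dq) * (x * sqrt dq + y * sqrt dp)"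
      "crossing_const P + crossing_const Q = 2 * pi / (sqrt dp * sqrt dq) * (sqrt dp + sqrt dq)"
      unfolding cc using s by (simp_all add: field_simps)
    have "2 * pi / (sqrt dp * sqrt dq) \<noteq> 0" using s by simp
    then have "(x * crossing_const P + y * crossing_const Q) / (crossing_const P + crossing_const Q)
        = (x * sqrt dq + y * sqrt dp) / (sqrt dp + sqrt dq)"
      unfolding e by (rule mult_divide_mult_cancel_left)
    then show ?thesis by (simp add: wp_def wq_def add_divide_distrib mult.commute)
  qed
  have "two_diracs wp p wq q \<in> p_omega F (to_torus X)"
  proof (rule two_diracs_in_p_omega[where F = F and x = "to_torus X", OF w cont tlim])
    fix f :: "torus \<Rightarrow> real" assume f: "continuous_on UNIV f"
    have c: "continuous_on UNIV (f \<circ> to_torus)"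
      by (intro continuous_on_compose continuous_to_torus continuous_on_subset[OF f]) auto
    have per: "(f \<circ> to_torus) x = (f \<circ> to_torus) y" if "torus_rel x y" for x y
      using that by (simp add: to_torus_eq_iff_torus_rel[symmetric])
    have fPQ: "(f \<circ> to_torus) P = f p" "(f \<circ> to_torus) Q = f q"
      by (simp_all add: P_def Q_def to_torus_rep_torus)
    \<comment> \<open>The normaliser \<open>D\<close> cancels, so the time average is a quotient of
      two known limits.\<close>
    have "(\<lambda>j. (T (f \<circ> to_torus) j / D j) / (t j / D j)) \<longlonglongrightarrow>
        2 * (f p * crossing_const P + f q * crossing_const Q) / (2 * (crossing_const P + crossing_const Q))"
      using ccpos by (intro tendsto_divide lim1 lim[OF c per, unfolded fPQ]) auto
    moreover have "(T (f \<circ> to_torus) j / D j) / (t j / D j) = 1 / t j * integral {0..t j} (\<lambda>s. f (F s (to_torus X)))" for j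
      using tT[OF c, of j] Dpos[of j] by (simp add: \<gamma>(3))
    moreover have "2 * (f p * crossing_const P + f q * crossing_const Q) / (2 * (crossing_const P + crossing_const Q)) = wp * f p + wq * f q"
      unfolding weights[symmetric] by (rule mult_divide_mult_cancel_left) simp
    ultimately show "(\<lambda>j. 1 / t j * integral {0..t j} (\<lambda>s. f (F s (to_torus X)))) \<longlonglongrightarrow> wp * f p + wq * f q"
      by (simp only:)
  qed
  then show ?thesis using X by (simp add: wp_def wq_def)
qed

end
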